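(* There is a polynomial-time algorithm to solve \textsc{EdgeAdd}: given a graph $G$ (possibly with self-loops) with vertex set $V$ and edge set $E$, find $\min\{|F| : F$ is a set of non-edges of $G$, containing no loops, such that $G+F$ has a perfect 2-matching$\}$.
   Context: $G+F$ denotes the graph obtained by adding the edges of $F$ to $G$. A perfect 2-matching in a graph with edge set $E$ is an assignment $x:E\to\{0,1,2\}$ such that $\sum_{e\in\delta(v)}x_e=2$ for every vertex $v$, where $\delta(v)$ is the set of edges incident to $v$. *)

theory Defs
  imports
    Complex_Main
    "HOL-Library.Extended_Nat"
    "HOL-Library.Log_Nat"
    "HOL-Computational_Algebra.Polynomial"
begin

section \<open>Graphs, perfect 2-matchings, and the problem EdgeAdd\<close>

text \<open>An undirected graph is a pair of a finite vertex set and a set of edges, each edge being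
  the set of its endpoints; a loop at \<open>v\<close> is the singleton \<open>{v}\<close>.\<close>

definition loop_graph :: "'a set \<Rightarrow> 'a set set \<Rightarrow> bool" where
  "loop_graph V E \<longleftrightarrow> finite V \<and> (\<forall>e\<in>E. e \<subseteq> V \<and> (card e = 1 \<or> card e = 2))"

definition incident_edges :: "'a set set \<Rightarrow> 'a \<Rightarrow> 'a set set" where
  "incident_edges E v = {e \<in> E. v \<in> e}"

definition perfect_2_matching :: "'a set \<Rightarrow> 'a set set \<Rightarrow> ('a set \<Rightarrow> nat) \<Rightarrow> bool" where
  "perfect_2_matching V E x \<longleftrightarrow>
     (\<forall>e\<in>E. x e \<in> {0, 1, 2}) \<and> (\<forall>v\<in>V. (\<Sum>e\<in>incident_edges E v. x e) = 2)"

definition loopless_non_edges :: "'a set \<Rightarrow> 'a set set \<Rightarrow> 'a set set" where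
  "loopless_non_edges V E = {e. e \<subseteq> V \<and> card e = 2 \<and> e \<notin> E}"

definition edge_add_feasible :: "'a set \<Rightarrow> 'a set set \<Rightarrow> 'a set set \<Rightarrow> bool" where
  "edge_add_feasible V E F \<longleftrightarrow>
     F \<subseteq> loopless_non_edges V E \<and> (\<exists>x. perfect_2_matching V (E \<union> F) x)"

text \<open>The minimum is \<open>\<infinity>\<close> if there is no feasible set (which happens for a single vertex
  without a loop).\<close>

definition edge_add :: "'a set \<Rightarrow> 'a set set \<Rightarrow> enat" where
  "edge_add V E = (INF F \<in> {F. edge_add_feasible V E F}. enat (card F))"


section \<open>Random access machines and polynomial time\<close>

text \<open>Structured programs for a random access machine whose memory cells hold natural numbers and
  which can add and (cut-off) subtract. \<open>Mem e\<close> is the content of the cell with address \<open>e\<close>, and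
  \<open>Store d e\<close> writes \<open>e\<close> into the cell with address \<open>d\<close>. Tests succeed on nonzero values. Every
  operation has cost 1. As there is no multiplication, the bit length of the numbers in memory
  grows by at most a constant in each step of a fixed program, so that polynomial time on this
  machine is polynomial time on Turing machines.\<close>

type_synonym mem = "nat \<Rightarrow> nat"

datatype exp = Num nat | Mem exp | Add exp exp | Sub exp exp

datatype prog =
    Skip
  | Store exp exp
  | Seq prog prog
  | IfElse exp prog prog
  | While exp prog

fun exp_val :: "exp \<Rightarrow> mem \<Rightarrow> nat" where
  "exp_val (Num k) m = k"
| "exp_val (Mem e) m = m (exp_val e m)"
| "exp_val (Add d e) m = exp_val d m + exp_val e m"
| "exp_val (Sub d e) m = exp_val d m - exp_val e m"

fun exp_cost :: "exp \<Rightarrow> nat" where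
  "exp_cost (Num k) = 1"
| "exp_cost (Mem e) = exp_cost e + 1"
| "exp_cost (Add d e) = exp_cost d + exp_cost e + 1"
| "exp_cost (Sub d e) = exp_cost d + exp_cost e + 1"

text \<open>\<open>runs c m t m'\<close>: started in memory \<open>m\<close>, program \<open>c\<close> halts in memory \<open>m'\<close> after time \<open>t\<close>.\<close>

inductive runs :: "prog \<Rightarrow> mem \<Rightarrow> nat \<Rightarrow> mem \<Rightarrow> bool" where
  Skip: "runs Skip m 1 m"
| Store: "runs (Store d e) m (exp_cost d + exp_cost e + 1) (m(exp_val d m := exp_val e m))"
| Seq: "runs c m s m' \<Longrightarrow> runs c' m' t m'' \<Longrightarrow> runs (Seq c c') m (s + t) m''"
| IfTrue: "exp_val b m \<noteq> 0 \<Longrightarrow> runs c m t m' \<Longrightarrow> runs (IfElse b c c') m (exp_cost b + 1 + t) m'"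
| IfFalse: "exp_val b m = 0 \<Longrightarrow> runs c' m t m' \<Longrightarrow> runs (IfElse b c c') m (exp_cost b + 1 + t) m'"
| WhileFalse: "exp_val b m = 0 \<Longrightarrow> runs (While b c) m (exp_cost b + 1) m"
| WhileTrue: "exp_val b m \<noteq> 0 \<Longrightarrow> runs c m s m' \<Longrightarrow> runs (While b c) m' t m'' \<Longrightarrow>
    runs (While b c) m (exp_cost b + 1 + s + t) m''"

inductive_cases runs_SkipE: "runs Skip m t m'"
inductive_cases runs_StoreE: "runs (Store d e) m t m'"
inductive_cases runs_SeqE: "runs (Seq c c') m t m'"
inductive_cases runs_IfElseE: "runs (IfElse b c c') m t m'"
inductive_cases runs_WhileE: "runs (While b c) m t m'"

lemma runs_deterministic:
  "runs c m t m' \<Longrightarrow> runs c m s m'' \<Longrightarrow> s = t \<and> m'' = m'"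
proof (induction arbitrary: s m'' rule: runs.induct)
  case (Skip m)
  then show ?case by (rule runs_SkipE) simp
next
  case (Store d e m)
  then show ?case by (rule runs_StoreE) simp
next
  case (Seq c m s1 m1 c' t m2)
  from Seq.prems show ?case
  proof (rule runs_SeqE)
    fix s' m' t'
    assume *: "s = s' + t'" "runs c m s' m'" "runs c' m' t' m''"
    from Seq.IH(1)[OF *(2)] have "s' = s1" "m' = m1" by simp_all
    with * Seq.IH(2)[of t' m''] show ?thesis by simp
  qed
next
  case (IfTrue b m c t m1 c')
  from IfTrue.prems show ?case
  proof (rule runs_IfElseE)
    fix t'
    assume "s = Suc (exp_cost b + t')" "runs c m t' m''"
    with IfTrue.IH[of t' m''] show ?thesis by simp
  qed (use IfTrue.hyps in simp)
next
  case (IfFalse b m c' t m1 c)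
  from IfFalse.prems show ?case
  proof (rule runs_IfElseE)
    fix t'
    assume "s = Suc (exp_cost b + t')" "runs c' m t' m''"
    with IfFalse.IH[of t' m''] show ?thesis by simp
  qed (use IfFalse.hyps in simp)
next
  case (WhileFalse b m c)
  from WhileFalse.prems show ?case
    by (rule runs_WhileE) (use WhileFalse.hyps in simp_all)
next
  case (WhileTrue b m c s1 m1 t m2)
  from WhileTrue.prems show ?case
  proof (rule runs_WhileE)
    fix s' m' t'
    assume *: "s = Suc (exp_cost b + s' + t')" "runs c m s' m'" "runs (While b c) m' t' m''"
    from WhileTrue.IH(1)[OF *(2)] have "s' = s1" "m' = m1" by simp_all
    with * WhileTrue.IH(2)[of t' m''] show ?thesis by simp
  qed (use WhileTrue.hyps(1) in simp)
qed

definition load_input :: "nat list \<Rightarrow> mem" where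
  "load_input w = (\<lambda>i. if i < length w then w ! i else 0)"

text \<open>The input size counts the bits of every entry, plus one for a separator.\<close>

definition input_size :: "nat list \<Rightarrow> nat" where
  "input_size w = (\<Sum>a\<leftarrow>w. floorlog 2 a + 1)"

text \<open>Cell 0 of the final memory tells whether the result is finite; if so, cell 1 holds it.\<close>

definition has_output :: "mem \<Rightarrow> enat \<Rightarrow> bool" where
  "has_output m r \<longleftrightarrow> (case r of enat k \<Rightarrow> m 0 = 1 \<and> m 1 = k | \<infinity> \<Rightarrow> m 0 = 0)"

definition poly_time_computable :: "'i set \<Rightarrow> ('i \<Rightarrow> nat list) \<Rightarrow> ('i \<Rightarrow> enat) \<Rightarrow> bool" where
  "poly_time_computable I enc f \<longleftrightarrow>
     (\<exists>(c :: prog) (p :: nat poly). \<forall>i\<in>I. \<exists>t m.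
        runs c (load_input (enc i)) t m \<and>
        t \<le> poly p (input_size (enc i)) \<and>
        has_output m (f i))"

text \<open>A graph is presented by a list \<open>vs\<close> of its vertices, in any order, and its edges. The
  machine is given the number of vertices followed by the rows of the adjacency matrix; the
  diagonal entries record the loops.\<close>

definition adjacency_encoding :: "'a list \<times> 'a set set \<Rightarrow> nat list" where
  "adjacency_encoding = (\<lambda>(vs, E).
     length vs # concat (map (\<lambda>u. map (\<lambda>v. if {u, v} \<in> E then 1 else 0) vs) vs))"

end

theory Submission
  imports Defs
begin

text \<open>A perfect 2-matching exists iff some permutation of \<open>V\<close> maps every vertex along an edge
  (a loop being used by a fixed point): one direction is Hall's theorem in the bipartite double
  cover, and the other one is immediate. Let \<open>d = |V| - \<nu>\<close>, where \<open>\<nu>\<close> is the matching number of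
  the double cover. A maximum matching of the double cover can be turned into a permutation of a
  set \<open>S\<close> of \<open>\<nu>\<close> vertices. Joining the \<open>d\<close> remaining vertices in pairs shows that \<open>d / 2\<close> edges
  suffice if \<open>d\<close> is even, and that is optimal since a new edge raises \<open>\<nu>\<close> by at most 2. If \<open>d\<close> is
  odd, then \<open>(d + 1) / 2\<close> edges suffice iff there is a non-isolated vertex \<open>u\<close> whose deletion
  lowers \<open>\<nu>\<close> by at most 1. Otherwise \<open>(d + 3) / 2\<close> edges are needed, and they suffice unless
  there is just one vertex, because the last vertex can be inserted into a cycle at the cost of two
  edges. So it is enough to compute the matching numbers of \<open>G\<close> and of all \<open>G - u\<close>; this is done
  with an auction algorithm, whose final prices also yield a Koenig certificate.\<close>

section \<open>Matchings of the double cover and permutations along edges\<close>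

text \<open>The parity of \<open>d\<close> is the obstacle. A permutation along the enlarged edge
  set uses at least \<open>d\<close> arcs outside \<open>E\<close>, and a new edge offers two arcs,
  one per direction. For odd \<open>d\<close> and \<open>(d + 1) / 2\<close> new edges only one arc
  is to spare, so all new edges but at most one are traversed both ways; this singles out the vertex
  \<open>u\<close>. Deleting a vertex can lower \<nu> by 2, as both of its copies disappear, whereas
  deleting an isolated one costs nothing, which is why \<open>u\<close> must have an edge. A single
  edge together with an isolated vertex has \<open>d = 1\<close> and needs two new edges. The
  matching number is found by an auction because the algorithm has to be a program of counting
  loops: one local step is repeated, and the bounded sum of prices takes the place of a search for
  augmenting paths. The invariant of that step is stated for plain functions, so that it serves both
  the program and the existence of Koenig certificates for arbitrary finite \<open>V\<close>, which
  the Hall direction needs.\<close>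

definition partial_matching :: "'a set \<Rightarrow> ('a \<Rightarrow> 'a \<Rightarrow> bool) \<Rightarrow> ('a \<Rightarrow> 'a) \<Rightarrow> 'a set \<Rightarrow> bool" where
  "partial_matching V R f D \<longleftrightarrow> D \<subseteq> V \<and> inj_on f D \<and> f ` D \<subseteq> V \<and> (\<forall>x\<in>D. R x (f x))"

definition matching_number :: "'a set \<Rightarrow> ('a \<Rightarrow> 'a \<Rightarrow> bool) \<Rightarrow> nat" where
  "matching_number V R = Max {card D | D. \<exists>f. partial_matching V R f D}"

text \<open>Both copies of \<open>u\<close> lose their arcs, but the vertex set stays the same.
  Hence matching numbers of different deletions live on the same \<open>V\<close>, and a
  \<open>u\<close> outside \<open>V\<close> deletes nothing.\<close>

definition without :: "'a \<Rightarrow> ('a \<Rightarrow> 'a \<Rightarrow> bool) \<Rightarrow> 'a \<Rightarrow> 'a \<Rightarrow> bool" where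
  "without u R x y \<longleftrightarrow> R x y \<and> x \<noteq> u \<and> y \<noteq> u"

text \<open>As \<open>{u, u} = {u}\<close>, a loop becomes an arc from \<open>u\<close> to
  itself.\<close>

definition adjacent :: "'a set set \<Rightarrow> 'a \<Rightarrow> 'a \<Rightarrow> bool" where
  "adjacent E u v \<longleftrightarrow> {u, v} \<in> E"

definition permutes_along :: "'a set \<Rightarrow> 'a set set \<Rightarrow> ('a \<Rightarrow> 'a) \<Rightarrow> bool" where
  "permutes_along S E f \<longleftrightarrow> bij_betw f S S \<and> (\<forall>v\<in>S. {v, f v} \<in> E)"

text \<open>Candidates for new edges. Pairs that already lie in \<open>E\<close> are tolerated in
  all constructions and discarded only in \<open>edge_add_le\<close>.\<close>

definition pairs :: "'a set \<Rightarrow> 'a set set" where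
  "pairs V = {e. e \<subseteq> V \<and> card e = 2}"

section \<open>Matching numbers and their invariance under bijections\<close>

lemma matching_sizes_finite:
  assumes "finite V"
  shows "finite {card D | D. \<exists>f. partial_matching V R f D}"
proof (rule finite_subset)
  show "{card D | D. \<exists>f. partial_matching V R f D} \<subseteq> card ` Pow V"
    by (auto simp: partial_matching_def)
qed (use assms in simp)

lemma matching_number_ge:
  assumes "finite V" "partial_matching V R f D"
  shows "card D \<le> matching_number V R"
  unfolding matching_number_def
  by (rule Max_ge) (use assms matching_sizes_finite in blast)+

lemma matching_number_obtain:
  assumes "finite V"
  obtains f D where "partial_matching V R f D" "card D = matching_number V R"
proof -
  have "partial_matching V R id {}" by (simp add: partial_matching_def)
  then have "{card D | D. \<exists>f. partial_matching V R f D} \<noteq> {}" by blast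
  from Max_in[OF matching_sizes_finite[OF assms] this]
  obtain f D where "partial_matching V R f D" "card D = matching_number V R"
    unfolding matching_number_def by auto
  then show ?thesis by (rule that)
qed

lemma matching_number_le_card:
  assumes "finite V"
  shows "matching_number V R \<le> card V"
proof -
  obtain f D where *: "partial_matching V R f D" "card D = matching_number V R"
    using matching_number_obtain[OF assms] .
  then have "D \<subseteq> V" by (simp add: partial_matching_def)
  then show ?thesis using * card_mono[OF assms] by metis
qed

lemma matching_number_eqI:
  assumes "finite V" "partial_matching V R f D"
    and "\<And>f' D'. partial_matching V R f' D' \<Longrightarrow> card D' \<le> card D"
  shows "matching_number V R = card D"
  by (metis assms matching_number_ge matching_number_obtain le_antisym)

lemma partial_matching_transfer:
  assumes h: "bij_betw h V W" and R: "\<And>x y. x \<in> V \<Longrightarrow> y \<in> V \<Longrightarrow> R x y \<Longrightarrow> R' (h x) (h y)"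
    and m: "partial_matching V R f D"
  shows "partial_matching W R' (h \<circ> f \<circ> inv_into V h) (h ` D)" "card (h ` D) = card D"
proof -
  have D: "D \<subseteq> V" "inj_on f D" "f ` D \<subseteq> V" "\<forall>x\<in>D. R x (f x)"
    using m by (auto simp: partial_matching_def)
  have inj: "inj_on h V" and im: "h ` V = W" using h by (auto simp: bij_betw_def)
  have inv: "inv_into V h (h x) = x" if "x \<in> D" for x
    using that D inj by (auto intro: inv_into_f_f)
  show "card (h ` D) = card D" by (meson card_image inj_on_subset inj D(1))
  have "inj_on (h \<circ> f \<circ> inv_into V h) (h ` D)"
  proof (rule inj_onI)
    fix a b assume "a \<in> h ` D" "b \<in> h ` D"
      and eq: "(h \<circ> f \<circ> inv_into V h) a = (h \<circ> f \<circ> inv_into V h) b"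
    then obtain x y where xy: "x \<in> D" "y \<in> D" "a = h x" "b = h y" by blast
    with eq inv have "h (f x) = h (f y)" by simp
    then have "f x = f y" using inj D xy by (meson image_subset_iff inj_onD)
    then show "a = b" using D xy by (metis inj_onD)
  qed
  then show "partial_matching W R' (h \<circ> f \<circ> inv_into V h) (h ` D)"
    unfolding partial_matching_def using D inv im R by (auto simp: image_subset_iff subset_iff)
qed

lemma matching_number_transfer_le:
  assumes "finite W" "bij_betw h V W"
    and "\<And>x y. x \<in> V \<Longrightarrow> y \<in> V \<Longrightarrow> R x y \<Longrightarrow> R' (h x) (h y)"
  shows "matching_number V R \<le> matching_number W R'"
proof -
  have "finite V" using assms by (simp add: bij_betw_finite)
  then obtain f D where m: "partial_matching V R f D" "card D = matching_number V R"
    by (rule matching_number_obtain)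
  note t = partial_matching_transfer[where R = R and R' = R', OF assms(2) _ m(1)]
  have "partial_matching W R' (h \<circ> f \<circ> inv_into V h) (h ` D)" by (rule t(1)) (use assms(3) in blast)
  from matching_number_ge[OF assms(1) this] show ?thesis using t(2) assms(3) m(2) by metis
qed

text \<open>Passes between vertices and their indices; with \<open>h = id\<close> it also identifies
  relations that agree only on \<open>V\<close>.\<close>

lemma matching_number_transfer:
  assumes "finite W" "bij_betw h V W"
    and R: "\<And>x y. x \<in> V \<Longrightarrow> y \<in> V \<Longrightarrow> R x y \<longleftrightarrow> R' (h x) (h y)"
  shows "matching_number V R = matching_number W R'"
proof (rule antisym)
  show "matching_number V R \<le> matching_number W R'"
    by (rule matching_number_transfer_le[OF assms(1,2)]) (use R in blast)
  have "R (inv_into V h x) (inv_into V h y)" if "x \<in> W" "y \<in> W" "R' x y" for x y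
  proof -
    have "inv_into V h x \<in> V" "inv_into V h y \<in> V" "h (inv_into V h x) = x" "h (inv_into V h y) = y"
      using that assms(2) by (auto simp: bij_betw_def inv_into_into f_inv_into_f)
    then show ?thesis using R that by metis
  qed
  then show "matching_number W R' \<le> matching_number V R"
    by (intro matching_number_transfer_le[of _ "inv_into V h"] bij_betw_inv_into assms(2))
      (use assms(1,2) bij_betw_finite in blast)
qed

section \<open>Building permutations along edges\<close>

lemma permutes_along_insert_loop:
  assumes "permutes_along S E f" "a \<notin> S" "{a} \<in> E"
  shows "permutes_along (insert a S) E (f(a := a))"
proof -
  have "bij_betw (f(a := a)) S S"
    using assms by (subst bij_betw_cong[of S _ f]) (auto simp: permutes_along_def)
  moreover have "bij_betw (f(a := a)) {a} {a}" by (simp add: bij_betw_def)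
  ultimately have "bij_betw (f(a := a)) (S \<union> {a}) (S \<union> {a})"
    by (rule bij_betw_combine) (use assms in auto)
  then show ?thesis using assms by (auto simp: permutes_along_def)
qed

lemma permutes_along_insert_pair:
  assumes "permutes_along S E f" "a \<notin> S" "b \<notin> S" "{a, b} \<in> E"
  shows "permutes_along (insert a (insert b S)) E (f(a := b, b := a))"
proof -
  let ?g = "f(a := b, b := a)"
  have "bij_betw ?g S S"
    using assms by (subst bij_betw_cong[of S _ f]) (auto simp: permutes_along_def)
  moreover have "bij_betw ?g {a, b} {a, b}" by (auto simp: bij_betw_def inj_on_def)
  ultimately have "bij_betw ?g (S \<union> {a, b}) (S \<union> {a, b})"
    by (rule bij_betw_combine) (use assms in auto)
  moreover have "S \<union> {a, b} = insert a (insert b S)" by auto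
  ultimately show ?thesis using assms by (auto simp: permutes_along_def insert_commute)
qed

text \<open>The vertex \<open>a\<close> is spliced into the arc from \<open>t\<close> to
  \<open>f t\<close>. If \<open>t\<close> is a fixed point, a transposition arises and the two
  required edges coincide.\<close>

lemma permutes_along_insert_between:
  assumes "permutes_along S E f" "t \<in> S" "a \<notin> S" "{t, a} \<in> E" "{a, f t} \<in> E"
  shows "permutes_along (insert a S) E (f(t := a, a := f t))"
proof -
  let ?g = "f(t := a, a := f t)"
  have inj: "inj_on f S" and im: "f ` S = S" using assms by (auto simp: permutes_along_def bij_betw_def)
  have "inj_on ?g (insert a S)"
    using inj im assms(2,3) by (auto simp: inj_on_def)
  moreover have "?g ` insert a S = insert a S"
  proof -
    have "?g ` insert a S = insert (f t) (insert a (f ` (S - {t})))"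
      using assms(2,3) by (auto simp: image_iff)
    also have "\<dots> = insert a (f ` S)" using assms(2) by auto
    finally show ?thesis using im by simp
  qed
  ultimately show ?thesis using assms by (auto simp: permutes_along_def bij_betw_def)
qed

lemma permutes_along_partial_matching:
  assumes "permutes_along S E f" "S \<subseteq> V"
  shows "partial_matching V (adjacent E) f S"
  using assms by (auto simp: permutes_along_def partial_matching_def bij_betw_def adjacent_def)

lemma permutes_along_card_le:
  assumes "permutes_along S E f" "S \<subseteq> V" "finite V"
  shows "card S \<le> matching_number V (adjacent E)"
  using permutes_along_partial_matching[OF assms(1,2)] matching_number_ge assms(3) by blast

lemma permutes_along_mono:
  assumes "permutes_along S E f" "E \<subseteq> E'"
  shows "permutes_along S E' f"
  using assms by (auto simp: permutes_along_def)

text \<open>A maximal path \<open>a, f a, \<dots>\<close> of the matching is broken up, from its start, into transpositions;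
  at most its last vertex, which is not in the domain, gets lost.\<close>

lemma permutes_along_of_partial_matching:
  assumes "finite V" "partial_matching V (adjacent E) f D"
  obtains S g where "S \<subseteq> V" "permutes_along S E g" "card D \<le> card S"
proof -
  have "\<exists>S g. S \<subseteq> V \<and> permutes_along S E g \<and> card D \<le> card S"
    using assms
  proof (induction "card V" arbitrary: V D rule: less_induct)
    case less
    have D: "D \<subseteq> V" "inj_on f D" "f ` D \<subseteq> V" "\<forall>x\<in>D. {x, f x} \<in> E"
      using less.prems(2) by (auto simp: partial_matching_def adjacent_def)
    have finD: "finite D" using D(1) less.prems(1) finite_subset by blast
    show ?case
    proof (cases "D \<subseteq> f ` D")
      case True
      then have "f ` D = D" using finD D(2) by (metis card_image card_subset_eq finite_imageI)
      then have "permutes_along D E f" using D by (simp add: permutes_along_def bij_betw_def)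
      then show ?thesis using D(1) by blast
    next
      case False
      then obtain a where a: "a \<in> D" "a \<notin> f ` D" by blast
      let ?b = "f a" and ?D = "D - {a, f a}" and ?V = "V - {a, f a}"
      have ab: "a \<noteq> ?b" "a \<in> V" "?b \<in> V" using a D by auto
      have "card ?V < card V" using ab less.prems(1) by (intro psubset_card_mono) auto
      moreover have "partial_matching ?V (adjacent E) f ?D"
        unfolding partial_matching_def adjacent_def
        using D a by (auto simp: inj_on_def)
      ultimately obtain S g where S: "S \<subseteq> ?V" "permutes_along S E g" "card ?D \<le> card S"
        using less.hyps[of ?V ?D] less.prems(1) by auto
      have fS: "finite S" using S(1) less.prems(1) by (meson finite_Diff finite_subset)
      have "permutes_along (insert a (insert ?b S)) E (g(a := ?b, ?b := a))"
        by (rule permutes_along_insert_pair) (use S D a in auto)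
      moreover have "card D \<le> card (insert a (insert ?b S))"
      proof -
        have "card D \<le> card (insert a (insert ?b ?D))"
          by (rule card_mono) (use finD in auto)
        also have "\<dots> = card ?D + 2" using finD ab by simp
        also have "\<dots> \<le> card S + 2" using S by simp
        also have "\<dots> = card (insert a (insert ?b S))" using fS S(1) ab by (subst card_insert_disjoint; force)+
        finally show ?thesis .
      qed
      moreover have "insert a (insert ?b S) \<subseteq> V" using S(1) ab by auto
      ultimately show ?thesis by blast
    qed
  qed
  then show ?thesis using that by blast
qed

lemma maximum_permutation:
  assumes "finite V"
  obtains S g where "S \<subseteq> V" "permutes_along S E g" "card S = matching_number V (adjacent E)"
proof -
  obtain f D where m: "partial_matching V (adjacent E) f D" "card D = matching_number V (adjacent E)"
    using matching_number_obtain[OF assms] .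
  obtain S g where S: "S \<subseteq> V" "permutes_along S E g" "card D \<le> card S"
    using permutes_along_of_partial_matching[OF assms m(1)] .
  then show ?thesis
    by (metis S m(2) permutes_along_card_le[OF S(2,1) assms] le_antisym that)
qed

lemma maximum_permutation_without:
  assumes "finite V"
  obtains S g where "S \<subseteq> V - {u}" "permutes_along S E g"
    "card S = matching_number V (without u (adjacent E))"
proof -
  let ?E = "{e \<in> E. u \<notin> e}"
  have eq: "without u (adjacent E) = adjacent ?E"
    by (auto simp: without_def adjacent_def fun_eq_iff)
  obtain S g where S: "S \<subseteq> V" "permutes_along S ?E g" "card S = matching_number V (adjacent ?E)"
    using maximum_permutation[OF assms] .
  have "u \<notin> S" using S(2) by (auto simp: permutes_along_def)
  then show ?thesis using that[of S g] S permutes_along_mono[of S ?E g E] by (auto simp: eq)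
qed

lemma pair_up:
  assumes "finite V" "S \<subseteq> V" "permutes_along S E g" "card (V - S) = 2 * k"
  obtains F f where "F \<subseteq> pairs V" "finite F" "card F \<le> k" "permutes_along V (E \<union> F) f"
proof -
  have "\<exists>F f. F \<subseteq> pairs V \<and> finite F \<and> card F \<le> k \<and> permutes_along V (E \<union> F) f"
    using assms
  proof (induction k arbitrary: S E g)
    case 0
    then have "V - S = {}" by simp
    then have "V = S" using 0 by auto
    then show ?case using 0 by (intro exI[of _ "{}"]) auto
  next
    case (Suc k)
    then obtain a where a: "a \<in> V" "a \<notin> S" by (metis DiffE card.empty equals0I nat.distinct(1) mult_is_0 zero_neq_numeral)
    have "card (V - S - {a}) = 2 * k + 1" using Suc.prems a by simp
    then obtain b where b: "b \<in> V" "b \<notin> S" "b \<noteq> a"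
      by (metis DiffE Suc_eq_plus1 card.empty equals0I insertI1 nat.distinct(1))
    let ?S = "insert a (insert b S)" and ?E = "E \<union> {{a, b}}"
    have "permutes_along ?S ?E (g(a := b, b := a))"
      by (rule permutes_along_insert_pair) (use Suc.prems a b in \<open>auto simp: permutes_along_def\<close>)
    moreover have "card (V - ?S) = 2 * k"
    proof -
      have "V - ?S = V - S - {a} - {b}" by auto
      then show ?thesis using \<open>card (V - S - {a}) = 2 * k + 1\<close> b by simp
    qed
    ultimately obtain F f where F: "F \<subseteq> pairs V" "finite F" "card F \<le> k" "permutes_along V (?E \<union> F) f"
      using Suc.IH[of ?S ?E "g(a := b, b := a)"] Suc.prems(1,2) a b by blast
    have "card (insert {a, b} F) \<le> Suc k" using F by (simp add: card_insert_if)
    moreover have "{a, b} \<in> pairs V" using a b by (simp add: pairs_def)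
    ultimately show ?case using F
      by (intro exI[of _ "insert {a, b} F"] exI[of _ f]) (auto simp: Un_insert_right)
  qed
  then show ?thesis using that by blast
qed


section \<open>Perfect 2-matchings and permutations\<close>

lemma neighbours_incident_edges:
  assumes "loop_graph V E" "u \<in> V"
  shows "(\<Sum>e\<in>incident_edges E u. x e) = (\<Sum>v\<in>{v \<in> V. {u, v} \<in> E}. x {u, v})"
proof (rule sum.reindex_bij_betw[symmetric])
  show "bij_betw (\<lambda>v. {u, v}) {v \<in> V. {u, v} \<in> E} (incident_edges E u)"
    unfolding bij_betw_def
  proof
    show "inj_on (\<lambda>v. {u, v}) {v \<in> V. {u, v} \<in> E}"
      by (auto simp: inj_on_def doubleton_eq_iff)
    show "(\<lambda>v. {u, v}) ` {v \<in> V. {u, v} \<in> E} = incident_edges E u"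
    proof
      show "incident_edges E u \<subseteq> (\<lambda>v. {u, v}) ` {v \<in> V. {u, v} \<in> E}"
      proof
        fix e assume e: "e \<in> incident_edges E u"
        then have "e \<in> E" "u \<in> e" by (auto simp: incident_edges_def)
        moreover then have "e \<subseteq> V" "card e = 1 \<or> card e = 2" using assms(1) by (auto simp: loop_graph_def)
        ultimately have "\<exists>v\<in>e. e = {u, v}"
          by (auto simp: card_1_singleton_iff card_2_iff)
        then show "e \<in> (\<lambda>v. {u, v}) ` {v \<in> V. {u, v} \<in> E}"
          using \<open>e \<in> E\<close> \<open>e \<subseteq> V\<close> by auto
      qed
    qed (auto simp: incident_edges_def)
  qed
qed

text \<open>The weights form a symmetric matrix with all row sums 2. Rows in \<open>X\<close> have
  their whole weight in the columns \<open>?N\<close>, whose total weight is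
  \<open>2 * card ?N\<close>.\<close>

lemma perfect_2_matching_hall:
  assumes G: "loop_graph V E" and x: "perfect_2_matching V E x" and X: "X \<subseteq> V"
  shows "card X \<le> card {v \<in> V. \<exists>u\<in>X. {u, v} \<in> E}"
proof -
  let ?N = "{v \<in> V. \<exists>u\<in>X. {u, v} \<in> E}"
  let ?w = "\<lambda>u v. if {u, v} \<in> E then x {u, v} else 0"
  have fV: "finite V" using G by (simp add: loop_graph_def)
  have deg: "(\<Sum>v\<in>V. ?w u v) = 2" if "u \<in> V" for u
    using x that neighbours_incident_edges[OF G that, of x] fV
    by (simp add: perfect_2_matching_def sum.inter_filter)
  have "2 * card X = (\<Sum>u\<in>X. \<Sum>v\<in>V. ?w u v)"
    using deg X by (simp add: subset_iff)
  also have "\<dots> = (\<Sum>u\<in>X. \<Sum>v\<in>?N. ?w u v)"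
    by (intro sum.cong sum.mono_neutral_right refl) (use fV in auto)
  also have "\<dots> = (\<Sum>v\<in>?N. \<Sum>u\<in>X. ?w u v)" by (rule sum.swap)
  also have "\<dots> \<le> (\<Sum>v\<in>?N. \<Sum>u\<in>V. ?w u v)"
    by (intro sum_mono sum_mono2) (use fV X in auto)
  \<comment> \<open>Symmetry turns column sums into row sums.\<close>
  also have "\<dots> = (\<Sum>v\<in>?N. \<Sum>u\<in>V. ?w v u)"
    by (intro sum.cong refl) (metis insert_commute)
  also have "\<dots> = 2 * card ?N" using deg by simp
  finally show ?thesis by simp
qed

text \<open>Each arc puts weight 1 on its edge, so a transposition yields weight 2. A fixed point
  has to contribute 2, because a loop occurs only once in the degree sum.\<close>

lemma perfect_2_matching_of_permutation:
  assumes V: "finite V" and f: "permutes_along V E f" and E: "finite E"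
  shows "\<exists>x. perfect_2_matching V E x"
proof -
  have inj: "inj_on f V" and im: "f ` V = V" and edge: "\<And>v. v \<in> V \<Longrightarrow> {v, f v} \<in> E"
    using f by (auto simp: permutes_along_def bij_betw_def)
  let ?c = "\<lambda>v. if f v = v then 2 else 1 :: nat"
  define x where "x e = (\<Sum>v\<in>{v \<in> V. {v, f v} = e}. ?c v)" for e
  have deg: "(\<Sum>e\<in>incident_edges E v. x e) = 2" if v: "v \<in> V" for v
  proof -
    have "(\<Sum>e\<in>incident_edges E v. x e)
      = (\<Sum>e\<in>incident_edges E v. \<Sum>w\<in>{w \<in> {w \<in> V. w = v \<or> f w = v}. {w, f w} = e}. ?c w)"
      unfolding x_def by (intro sum.cong refl) (auto simp: incident_edges_def)
    also have "\<dots> = (\<Sum>w\<in>{w \<in> V. w = v \<or> f w = v}. ?c w)"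
      by (rule sum.group) (use V E edge in \<open>auto simp: incident_edges_def\<close>)
    also have "\<dots> = 2"
    proof -
      obtain w where w: "w \<in> V" "f w = v" using im v by (metis imageE)
      \<comment> \<open>Either \<open>v = w\<close> is a fixed point of weight 2, or the arcs
        leaving and entering \<open>v\<close> have weight 1 each.\<close>
      have "{w \<in> V. w = v \<or> f w = v} = {v, w}" using v w inj by (auto dest: inj_onD)
      then show ?thesis using w inj v by (cases "v = w") (auto dest: inj_onD)
    qed
    finally show ?thesis .
  qed
  \<comment> \<open>A single summand of a degree sum equal to 2 is at most 2; a set that misses
    \<open>V\<close> carries no weight.\<close>
  have "x e \<in> {0, 1, 2}" if "e \<in> E" for e
  proof (cases "\<exists>v\<in>V. v \<in> e")
    case True
    then obtain v where v: "v \<in> V" "v \<in> e" by blast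
    have "x e \<le> (\<Sum>e\<in>incident_edges E v. x e)"
      by (rule member_le_sum) (use that v E in \<open>auto simp: incident_edges_def\<close>)
    then show ?thesis using deg[OF v(1)] by auto
  next
    case False
    then have "{v \<in> V. {v, f v} = e} = {}" by auto
    then have "x e = 0" by (simp only: x_def sum.empty)
    then show ?thesis by simp
  qed
  then show ?thesis using deg unfolding perfect_2_matching_def by blast
qed

lemma finite_loop_graph: "loop_graph V E \<Longrightarrow> finite E"
  unfolding loop_graph_def by (meson PowI finite_Pow_iff finite_subset subsetI)

lemma loop_graph_Un_pairs: "loop_graph V E \<Longrightarrow> F \<subseteq> pairs V \<Longrightarrow> loop_graph V (E \<union> F)"
  by (auto simp: loop_graph_def pairs_def)

section \<open>Counting new edges\<close>

lemma edge_add_le: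
  assumes G: "loop_graph V E" and F: "F \<subseteq> pairs V" and f: "permutes_along V (E \<union> F) f"
    and k: "card F \<le> k"
  shows "edge_add V E \<le> enat k"
proof -
  have fin: "finite (E \<union> F)" "finite V" using finite_loop_graph loop_graph_Un_pairs[OF G F] G
    by (auto simp: loop_graph_def)
  have "edge_add_feasible V E (F - E)"
    using perfect_2_matching_of_permutation[OF fin(2) f fin(1)] F
    by (auto simp: edge_add_feasible_def loopless_non_edges_def pairs_def)
  then have "edge_add V E \<le> enat (card (F - E))"
    unfolding edge_add_def by (auto intro: INF_lower)
  also have "\<dots> \<le> enat k" using k fin by (simp add: card_Diff_subset_Int le_trans[OF card_mono[of F "F - E"]])
  finally show ?thesis .
qed

lemma edge_add_le_pair_up:
  assumes G: "loop_graph V E" and F: "F \<subseteq> pairs V" and S: "S \<subseteq> V" "permutes_along S (E \<union> F) g"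
    and c: "card (V - S) = 2 * k" "card F \<le> l"
  shows "edge_add V E \<le> enat (l + k)"
proof -
  have V: "finite V" using G by (simp add: loop_graph_def)
  obtain F' f where F': "F' \<subseteq> pairs V" "finite F'" "card F' \<le> k" "permutes_along V (E \<union> F \<union> F') f"
    using pair_up[OF V S c(1)] .
  have "card (F \<union> F') \<le> l + k" using card_Un_le[of F F'] F'(3) c(2) by linarith
  then show ?thesis using edge_add_le[OF G, of "F \<union> F'" f] F F' by (simp add: Un_assoc)
qed

text \<open>An edge can be traversed only from its two endpoints, so every fibre of the map from
  \<open>v\<close> to \<open>{v, f v}\<close> has at most two elements.\<close>

lemma card_le_twice_pairs:
  assumes "finite F" "\<And>e. e \<in> F \<Longrightarrow> card e = 2" "\<And>v. v \<in> W \<Longrightarrow> {v, f v} \<in> F"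
  shows "card W \<le> 2 * card F"
proof -
  have "finite (\<Union>F)" using assms by (metis card.infinite finite_Union zero_neq_numeral)
  then have fin: "finite W" by (rule finite_subset[rotated]) (use assms(3) in blast)
  have "card W = (\<Sum>e\<in>F. card {v \<in> W. {v, f v} = e})"
    using sum.group[OF fin assms(1), of "\<lambda>v. {v, f v}" "\<lambda>_. 1 :: nat"] assms(3)
    by (auto simp: image_subset_iff)
  also have "\<dots> \<le> (\<Sum>e\<in>F. 2)"
  proof (rule sum_mono)
    fix e assume "e \<in> F"
    then have "card e = 2" by (rule assms)
    moreover from this have "finite e" using card.infinite by fastforce
    ultimately show "card {v \<in> W. {v, f v} = e} \<le> 2"
      using card_mono[of e "{v \<in> W. {v, f v} = e}"] by auto
  qed
  finally show ?thesis by simp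
qed

text \<open>The orbits partition \<open>W\<close> into blocks of size 2.\<close>

lemma fixpoint_free_involution_even:
  assumes "finite W" "\<And>v. v \<in> W \<Longrightarrow> f v \<in> W \<and> f v \<noteq> v \<and> f (f v) = v"
  shows "even (card W)"
proof -
  let ?C = "(\<lambda>v. {v, f v}) ` W"
  have "\<Union>?C = W" using assms(2) by auto
  moreover have "2 * card ?C = card (\<Union>?C)"
  proof (rule card_partition)
    show "finite (\<Union>?C)" using assms(1) by simp
    show "card c = 2" if "c \<in> ?C" for c using that assms(2) by (auto simp: card_2_iff)
    show "c1 \<inter> c2 = {}" if c: "c1 \<in> ?C" "c2 \<in> ?C" "c1 \<noteq> c2" for c1 c2
    proof -
      obtain v w where vw: "v \<in> W" "w \<in> W" "c1 = {v, f v}" "c2 = {w, f w}"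
        using c(1,2) by auto
      have inv: "f (f v) = v" "f (f w) = w" using assms(2) vw(1,2) by blast+
      have ne: "w \<noteq> v" "w \<noteq> f v" using vw(3,4) c(3) inv(1) by (metis, metis insert_commute)
      then have "f w \<noteq> v" "f w \<noteq> f v" using inv by metis+
      then show ?thesis unfolding vw(3,4) using ne by (simp add: disjoint_iff eq_commute)
    qed
  qed (use assms(1) in simp)
  ultimately show ?thesis by (metis dvd_triv_left)
qed

section \<open>Bounds on \<open>edge_add\<close> in terms of the deficiency \<open>d\<close>\<close>

context
  fixes V :: "'a set" and E :: "'a set set" and n d :: nat
  assumes G: "loop_graph V E"
  defines "n \<equiv> card V"
  defines "d \<equiv> n - matching_number V (adjacent E)"
begin

lemma finite_V: "finite V"
  using G by (simp add: loop_graph_def)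

lemma deficiency: "matching_number V (adjacent E) + d = n"
  using matching_number_le_card[OF finite_V, of "adjacent E"] by (simp add: d_def n_def)

lemma edge_add_le_even:
  assumes "even d"
  shows "edge_add V E \<le> enat (d div 2)"
proof -
  obtain S g where S: "S \<subseteq> V" "permutes_along S E g" "card S = matching_number V (adjacent E)"
    using maximum_permutation[OF finite_V] .
  have "card (V - S) = 2 * (d div 2)"
    using S finite_V deficiency assms by (simp add: card_Diff_subset finite_subset n_def d_def)
  then show ?thesis using edge_add_le_pair_up[OF G, of "{}" S g "d div 2" 0] S by simp
qed

lemma edge_add_le_odd:
  assumes "odd d" "n \<noteq> 1"
  shows "edge_add V E \<le> enat (d div 2 + 2)"
proof -
  obtain S g where S: "S \<subseteq> V" "permutes_along S E g" "card S = matching_number V (adjacent E)"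
    using maximum_permutation[OF finite_V] .
  have "card (V - S) = d"
    using S finite_V by (simp add: card_Diff_subset finite_subset n_def d_def)
  then have c: "card (V - S) = 2 * (d div 2) + 1" using assms(1) by simp
  then obtain w where w: "w \<in> V" "w \<notin> S"
    by (metis DiffE Suc_eq_plus1 card.empty equals0I nat.distinct(1))
  let ?V = "V - {w}"
  have "?V - S = V - S - {w}" by auto
  then have "card (?V - S) = 2 * (d div 2)" using c w by simp
  then obtain F f where F: "F \<subseteq> pairs ?V" "finite F" "card F \<le> d div 2" "permutes_along ?V (E \<union> F) f"
    using pair_up[of ?V S E g "d div 2"] finite_V S w by blast
  have "?V \<noteq> {}"
  proof
    assume "?V = {}"
    then have "V = {w}" using w by auto
    then show False using assms(2) by (simp add: n_def)
  qed
  then obtain t where t: "t \<in> ?V" by blast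
  have ft: "f t \<in> ?V" using F(4) t by (auto simp: permutes_along_def bij_betw_def)
  let ?F = "insert {t, w} (insert {w, f t} F)"
  have "permutes_along (insert w ?V) (E \<union> ?F) (f(t := w, w := f t))"
    by (rule permutes_along_insert_between) (use F(4) t in \<open>auto simp: permutes_along_def\<close>)
  then have "permutes_along V (E \<union> ?F) (f(t := w, w := f t))" using w by (simp add: insert_absorb)
  moreover have "?F \<subseteq> pairs V" using F(1) t ft w by (auto simp: pairs_def)
  \<comment> \<open>Only an inequality, as the two splicing edges coincide if \<open>t\<close> is a
    fixed point of \<open>f\<close>.\<close>
  moreover have "card ?F \<le> d div 2 + 2"
    using F(2,3) by (simp add: card_insert_if)
  ultimately show ?thesis using edge_add_le[OF G] by blast
qed

text \<open>A maximum permuted set \<open>S\<close> avoiding \<open>u\<close> has \<nu> or \<nu> - 1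
  elements. In the first case maximality forces \<open>v\<close> into \<open>S\<close>, and
  \<open>u\<close> is spliced in after \<open>v\<close> with the old edge \<open>{u, v}\<close> and
  one new edge. In the second case \<open>u\<close> is joined to another unpermuted vertex by one
  new edge. Either way the number of vertices left over is even, and they are paired up.\<close>

lemma edge_add_le_odd_special:
  assumes odd: "odd d" and uv: "u \<in> V" "v \<in> V" "{u, v} \<in> E"
    and le: "n \<le> matching_number V (without u (adjacent E)) + d + 1"
  shows "edge_add V E \<le> enat (d div 2 + 1)"
proof -
  let ?m = "matching_number V (without u (adjacent E))"
  obtain S g where S: "S \<subseteq> V - {u}" "permutes_along S E g" "card S = ?m"
    using maximum_permutation_without[OF finite_V] .
  have SV: "S \<subseteq> V" and uS: "u \<notin> S" and fS: "finite S" using S finite_V finite_subset by auto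
  have max: "card S' \<le> n - d" if "S' \<subseteq> V" "permutes_along S' E g'" for S' g'
    using permutes_along_card_le[OF that(2,1) finite_V] deficiency by simp
  have cV: "card (V - S) = n - ?m" "?m \<le> n"
    using SV fS S(3) card_mono[OF finite_V SV] by (auto simp: card_Diff_subset n_def)
  consider "card S = n - d" | "card S + d + 1 = n" using max[OF SV S(2)] le S(3) deficiency by linarith
  then show ?thesis
  proof cases
    case 1
    have "v \<noteq> u"
    proof
      assume "v = u"
      then have "permutes_along (insert u S) E (g(u := u))"
        using permutes_along_insert_loop[OF S(2) uS] uv by simp
      from max[OF _ this] show False using SV uv uS fS 1 by simp
    qed
    have "v \<in> S"
    proof (rule ccontr)
      assume "v \<notin> S"
      from max[OF _ permutes_along_insert_pair[OF S(2) uS this uv(3)]]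
      show False using SV uv uS fS 1 \<open>v \<noteq> u\<close> \<open>v \<notin> S\<close> by simp
    qed
    then have gv: "g v \<in> S" using S(2) by (auto simp: permutes_along_def bij_betw_def)
    let ?F = "{{u, g v}}"
    have "permutes_along (insert u S) (E \<union> ?F) (g(v := u, u := g v))"
      using permutes_along_insert_between[of S "E \<union> ?F" g v u] S(2) uS uv \<open>v \<in> S\<close>
      by (auto simp: permutes_along_def insert_commute)
    moreover have "?F \<subseteq> pairs V" using gv SV uS uv by (auto simp: pairs_def card_2_iff)
    moreover have "card (V - insert u S) = 2 * (d div 2)"
    proof -
      have "V - insert u S = V - S - {u}" by auto
      moreover have "card (V - S - {u}) = card (V - S) - 1" using uS uv by simp
      ultimately show ?thesis using cV 1 odd deficiency S(3) by simp
    qed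
    moreover have "insert u S \<subseteq> V" using SV uv by auto
    ultimately show ?thesis
      using edge_add_le_pair_up[OF G, of ?F "insert u S" _ "d div 2" 1] by (simp add: add.commute)
  next
    case 2
    have c: "card (V - S - {u}) = d" using cV 2 S(3) uS uv by simp
    then obtain w where w: "w \<in> V" "w \<notin> S" "w \<noteq> u"
      using odd by (metis DiffE card.empty equals0I even_zero insertI1)
    let ?F = "{{u, w}}" and ?S = "insert u (insert w S)"
    have "permutes_along ?S (E \<union> ?F) (g(u := w, w := u))"
      using permutes_along_insert_pair[of S "E \<union> ?F" g u w] S(2) uS w by (auto simp: permutes_along_def)
    moreover have "?F \<subseteq> pairs V" using w uv by (auto simp: pairs_def card_2_iff)
    moreover have "card (V - ?S) = 2 * (d div 2)"
    proof -
      have "V - ?S = V - S - {u} - {w}" by auto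
      then show ?thesis using c w odd by simp
    qed
    moreover have "?S \<subseteq> V" using SV uv w by auto
    ultimately show ?thesis
      using edge_add_le_pair_up[OF G, of ?F ?S _ "d div 2" 1] by (simp add: add.commute)
  qed
qed

text \<open>Without its new arcs, the permutation is still a matching of the double cover of the
  original graph, hence has at most \<nu> arcs.\<close>

lemma new_arcs_ge:
  assumes f: "permutes_along V (E \<union> F) f"
  shows "d \<le> card {v \<in> V. {v, f v} \<notin> E}"
proof -
  let ?W = "{v \<in> V. {v, f v} \<notin> E}"
  have "partial_matching V (adjacent E) f (V - ?W)"
    using f by (auto simp: partial_matching_def permutes_along_def bij_betw_def adjacent_def inj_on_def)
  from matching_number_ge[OF finite_V this] finite_V deficiency
  show ?thesis by (simp add: card_Diff_subset n_def)
qed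

lemma new_edges_ge:
  assumes f: "permutes_along V (E \<union> F) f" and F: "F \<subseteq> pairs V"
  shows "d \<le> 2 * card F"
proof -
  have "finite F" using finite_loop_graph[OF loop_graph_Un_pairs[OF G F]] by simp
  then have "card {v \<in> V. {v, f v} \<notin> E} \<le> 2 * card F"
    by (rule card_le_twice_pairs) (use F f in \<open>auto simp: pairs_def permutes_along_def\<close>)
  then show ?thesis using new_arcs_ge[OF f] by linarith
qed

text \<open>Since \<open>d\<close> is odd and \<open>2 * card F \<le> d + 1\<close>, at most one edge of \<open>F\<close> is traversed in only one
  direction by the permutation. Its tail, or otherwise any endpoint of an edge of \<open>F\<close> that is not
  isolated in \<open>E\<close>, can serve as \<open>u\<close>.\<close>

lemma odd_few_new_edges:
  assumes f: "permutes_along V (E \<union> F) f" and F: "F \<subseteq> pairs V" and odd: "odd d"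
    and few: "card F \<le> d div 2 + 1"
  shows "\<exists>u\<in>V. \<exists>v\<in>V. {u, v} \<in> E \<and> n \<le> matching_number V (without u (adjacent E)) + d + 1"
proof -
  have inj: "inj_on f V" and im: "f ` V = V" using f by (auto simp: permutes_along_def bij_betw_def)
  have finF: "finite F" using finite_loop_graph[OF loop_graph_Un_pairs[OF G F]] by simp
  have F2: "card e = 2" if "e \<in> F" for e using that F by (auto simp: pairs_def)
  define W where "W = {v \<in> V. {v, f v} \<notin> E}"
  have WF: "{v, f v} \<in> F" if "v \<in> W" for v using f that by (auto simp: permutes_along_def W_def)
  have W: "f v \<noteq> v" "v \<in> V" if "v \<in> W" for v
    using F2[OF WF[OF that]] that by (auto simp: W_def)
  have finW: "finite W" using finite_V by (simp add: W_def)
  have dW: "d \<le> card W" using new_arcs_ge[OF f] by (simp add: W_def)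
  have F_le: "2 * card F \<le> d + 1" using few odd by presburger
  \<comment> \<open>To avoid \<open>u\<close>, both the arc leaving it and the arc entering it must
    be dropped; \<open>X\<close> is meant for the tail of the latter.\<close>
  have matching: "partial_matching V (without u (adjacent E)) f (V - W - X)"
    if "u \<in> W \<union> X" "\<And>y. y \<in> V \<Longrightarrow> f y = u \<Longrightarrow> y \<in> W \<union> X" for u X
    using that inj im by (auto simp: partial_matching_def without_def adjacent_def W_def inj_on_def)
  have same_edge: "w = f v \<and> f w = v" if "v \<in> W" "w \<in> W" "w \<noteq> v" "{w, f w} = {v, f v}" for v w
    using that by (auto simp: doubleton_eq_iff)
  show ?thesis
  proof (cases "\<exists>u\<in>W. f (f u) \<noteq> u")
    case True
    then obtain u where u: "u \<in> W" "f (f u) \<noteq> u" by blast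
    obtain x where x: "x \<in> V" "f x = u" using im u W by (metis imageE)
    \<comment> \<open>The edge \<open>{u, f u}\<close> is traversed from \<open>u\<close> only, so
      removing it from \<open>F\<close> affects no other vertex of \<open>W\<close>. This sharpens
      the count to \<open>card W = d\<close>.\<close>
    have "card (W - {u}) \<le> 2 * card (F - {{u, f u}})"
    proof (rule card_le_twice_pairs)
      show "{v, f v} \<in> F - {{u, f u}}" if "v \<in> W - {u}" for v
        using WF[of v] same_edge[of u v] that u by auto
    qed (use finF F2 in auto)
    then have "card W - 1 \<le> 2 * (card F - 1)" using u finW WF by simp
    moreover have "card F \<ge> 1" using WF[OF u(1)] finF by (metis card_0_eq empty_iff less_one not_le)
    ultimately have cW: "card W = d" using dW F_le u finW by (cases "card W") auto
    \<comment> \<open>If the arc entering \<open>u\<close> were new too, \<open>F\<close> would have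
      a second edge traversed in one direction only, and
      \<open>d - 2 \<le> 2 * (card F - 2) \<le> d - 3\<close> would follow.\<close>
    have "x \<notin> W"
    proof
      assume xW: "x \<in> W"
      have xu: "x \<noteq> u" "f u \<noteq> x" using u x by auto
      have "{x, f x} \<noteq> {u, f u}" using xu x by (auto simp: doubleton_eq_iff)
      have "card (W - {u, x}) \<le> 2 * card (F - {{u, f u}, {x, f x}})"
      proof (rule card_le_twice_pairs)
        show "{v, f v} \<in> F - {{u, f u}, {x, f x}}" if "v \<in> W - {u, x}" for v
          using WF[of v] same_edge[of u v] same_edge[of x v] that u xW x by auto
      qed (use finF F2 in auto)
      moreover have "card (W - {u, x}) = d - 2" using u xW xu cW finW by simp
      moreover have "card (F - {{u, f u}, {x, f x}}) = card F - 2"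
        using WF u xW \<open>{x, f x} \<noteq> {u, f u}\<close> finF by (subst card_Diff_subset) auto
      moreover have "card F \<ge> 2"
        using card_mono[OF finF, of "{{u, f u}, {x, f x}}"] WF u xW \<open>{x, f x} \<noteq> {u, f u}\<close> by auto
      moreover have "d \<ge> 2" using card_mono[OF finW, of "{u, x}"] u xW xu cW by auto
      ultimately show False using F_le by linarith
    qed
    then have "{u, x} \<in> E" using x by (auto simp: W_def insert_commute)
    moreover have "card (V - W - {x}) + d + 1 = n"
    proof -
      have "x \<in> V - W" using x \<open>x \<notin> W\<close> by simp
      then have "card (V - W) > 0" using finite_V by (auto simp: card_gt_0_iff)
      moreover have "card (V - W) = n - d" 
        using cW finW W by (subst card_Diff_subset) (auto simp: n_def)
      ultimately show ?thesis using x \<open>x \<notin> W\<close> by simp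
    qed
    moreover have "partial_matching V (without u (adjacent E)) f (V - W - {x})"
      by (rule matching) (use u x inj in \<open>auto dest: inj_onD\<close>)
    ultimately show ?thesis
      using matching_number_ge[OF finite_V] u W x by (metis add_le_mono1 add.assoc)
  next
    case False
    have inv: "f v \<in> W \<and> f v \<noteq> v \<and> f (f v) = v" if "v \<in> W" for v
    proof -
      have "f v \<in> V" using that W im by blast
      then show ?thesis using that False W[OF that] by (auto simp: W_def insert_commute)
    qed
    \<comment> \<open>The new arcs now form transpositions, so their number is even and must be
      \<open>d + 1\<close>.\<close>
    have "card W \<noteq> d" using fixpoint_free_involution_even[OF finW, of f] inv odd by blast
    have cW: "card W \<le> d + 1"
    proof -
      have "card W \<le> 2 * card F" by (rule card_le_twice_pairs[OF finF F2 WF])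
      then show ?thesis using F_le by simp
    qed
    have "\<exists>u\<in>W. \<exists>v\<in>V. {u, v} \<in> E"
    proof (rule ccontr)
      \<comment> \<open>If all vertices of \<open>W\<close> were isolated in \<open>E\<close>, no
        matching could use them, and the deficiency would be at least
        \<open>card W = d + 1\<close>.\<close>
      assume iso: "\<not> ?thesis"
      obtain h D where m: "partial_matching V (adjacent E) h D" "card D = matching_number V (adjacent E)"
        using matching_number_obtain[OF finite_V] .
      have "D \<subseteq> V - W" using m(1) iso unfolding partial_matching_def adjacent_def by blast
      then have "card D \<le> card (V - W)" using finite_V by (simp add: card_mono)
      also have "\<dots> = n - card W" using finW W by (subst card_Diff_subset) (auto simp: n_def)
      finally have "card W \<le> d"
        using m(2) deficiency card_mono[OF finite_V, of W] W(2) by (simp add: n_def subset_iff)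
      then show False using dW \<open>card W \<noteq> d\<close> by simp
    qed
    then obtain u v where u: "u \<in> W" "v \<in> V" "{u, v} \<in> E" by blast
    have "partial_matching V (without u (adjacent E)) f (V - W - {})"
    proof (rule matching)
      show "y \<in> W \<union> {}" if "y \<in> V" "f y = u" for y
        using inv[OF u(1)] that inj W by (metis Un_iff inj_onD)
    qed (use u in simp)
    moreover have "card (V - W) = n - card W" using finW W by (subst card_Diff_subset) (auto simp: n_def)
    ultimately have "n \<le> matching_number V (without u (adjacent E)) + d + 1"
      using matching_number_ge[OF finite_V] cW by fastforce
    then show ?thesis using u W by blast
  qed
qed

end

section \<open>The auction algorithm\<close>

text \<open>Every right vertex \<open>j\<close> has a price \<open>p j\<close>; \<open>own j\<close> and \<open>mate i\<close> are the matched partners,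
  shifted by one so that 0 means unmatched. An unmatched \<open>i\<close> bids for a cheapest neighbour,
  displacing its owner and raising its price by one.\<close>

definition auction_inv ::
    "nat \<Rightarrow> (nat \<Rightarrow> nat \<Rightarrow> bool) \<Rightarrow> (nat \<Rightarrow> nat) \<Rightarrow> (nat \<Rightarrow> nat) \<Rightarrow> (nat \<Rightarrow> nat) \<Rightarrow> bool" where
  "auction_inv n R p own mate \<longleftrightarrow>
     (\<forall>i<n. mate i \<noteq> 0 \<longrightarrow> mate i \<le> n \<and> own (mate i - 1) = Suc i) \<and>
     (\<forall>j<n. own j \<noteq> 0 \<longrightarrow> own j \<le> n \<and> mate (own j - 1) = Suc j \<and> R (own j - 1) j \<and>
        (\<forall>k<n. R (own j - 1) k \<longrightarrow> p j \<le> p k + 1)) \<and>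
     (\<forall>j<n. p j > 0 \<longrightarrow> own j \<noteq> 0) \<and> (\<forall>j<n. p j \<le> n + 2)"

text \<open>The price \<open>n + 2\<close> is the cap at which bidding stops. An unmatched vertex
  without neighbours is stuck as well.\<close>

definition stuck :: "nat \<Rightarrow> (nat \<Rightarrow> nat \<Rightarrow> bool) \<Rightarrow> (nat \<Rightarrow> nat) \<Rightarrow> (nat \<Rightarrow> nat) \<Rightarrow> nat \<Rightarrow> bool" where
  "stuck n R p mate i \<longleftrightarrow> mate i = 0 \<longrightarrow> (\<forall>k<n. R i k \<longrightarrow> p k \<ge> n + 2)"

lemma auction_inv_init: "auction_inv n R (\<lambda>_. 0) (\<lambda>_. 0) (\<lambda>_. 0)"
  by (simp add: auction_inv_def)

text \<open>Partners, once shifted back, are again indices below \<open>n\<close>, so the invariant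
  never looks at other entries. The arrays of the program are initialised only there.\<close>

lemma auction_inv_cong:
  assumes "auction_inv n R p own mate"
    and "\<And>i. i < n \<Longrightarrow> p' i = p i \<and> own' i = own i \<and> mate' i = mate i"
  shows "auction_inv n R p' own' mate'"
proof -
  have "mate i - 1 < n" if "i < n" "mate i \<noteq> 0" for i
    using assms(1) that by (auto simp: auction_inv_def)
  moreover have "own i - 1 < n" if "i < n" "own i \<noteq> 0" for i
    using assms(1) that by (auto simp: auction_inv_def)
  ultimately show ?thesis using assms unfolding auction_inv_def by simp
qed

text \<open>The new owner took a cheapest neighbour, so raising that price by one uses up exactly
  the slack of one in the invariant. For all other owners the rise can only help. A price once
  raised always has an owner, since a displaced owner is replaced at once.\<close>

lemma auction_inv_bid:
  assumes inv: "auction_inv n R p own mate"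
    and i: "i < n" "mate i = 0" and j: "j < n" "R i j"
    and cheapest: "\<And>k. k < n \<Longrightarrow> R i k \<Longrightarrow> p j \<le> p k" and cap: "p j \<le> n + 1"
  shows "auction_inv n R (p(j := Suc (p j))) (own(j := Suc i))
    ((if own j = 0 then mate else mate(own j - 1 := 0))(i := Suc j))" (is "auction_inv n R ?p ?own ?mate")
proof -
  have mate: "\<And>i. i < n \<Longrightarrow> mate i \<noteq> 0 \<Longrightarrow> mate i \<le> n \<and> own (mate i - 1) = Suc i"
    and own: "\<And>j. j < n \<Longrightarrow> own j \<noteq> 0 \<Longrightarrow> own j \<le> n \<and> mate (own j - 1) = Suc j \<and> R (own j - 1) j \<and>
        (\<forall>k<n. R (own j - 1) k \<longrightarrow> p j \<le> p k + 1)"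
    and pos: "\<And>j. j < n \<Longrightarrow> p j > 0 \<Longrightarrow> own j \<noteq> 0" and bound: "\<And>j. j < n \<Longrightarrow> p j \<le> n + 2"
    using inv by (auto simp: auction_inv_def)
  have 1: "?mate i' \<le> n \<and> ?own (?mate i' - 1) = Suc i'" if "i' < n" "?mate i' \<noteq> 0" for i'
  proof (cases "i' = i")
    case False
    then have *: "mate i' \<noteq> 0" "own j \<noteq> Suc i'" using that by (auto split: if_splits)
    with mate[OF that(1)] have "mate i' - 1 \<noteq> j" by auto
    then show ?thesis using False * mate[OF that(1)] by auto
  qed (use j in simp)
  have 2: "?own j' \<le> n \<and> ?mate (?own j' - 1) = Suc j' \<and> R (?own j' - 1) j' \<and>
      (\<forall>k<n. R (?own j' - 1) k \<longrightarrow> ?p j' \<le> ?p k + 1)" if j': "j' < n" "?own j' \<noteq> 0" for j'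
  proof (cases "j' = j")
    case True
    then show ?thesis using i j cheapest by auto
  next
    case False
    then have o: "own j' \<noteq> 0" using j' by simp
    note oj = own[OF j'(1) o]
    have "own j' - 1 \<noteq> i" using oj i by auto
    moreover have "own j' - 1 \<noteq> own j - 1 \<or> own j = 0" using oj own[OF j(1)] False
      by (metis nat.inject)
    ultimately have "?mate (own j' - 1) = Suc j'" using oj by auto
    moreover have "p j' \<le> ?p k + 1" if "k < n" "R (own j' - 1) k" for k
      using oj that by (cases "k = j") fastforce+
    ultimately show ?thesis using oj False by simp
  qed
  show ?thesis unfolding auction_inv_def
  proof (intro conjI allI impI)
    show "?own j' \<noteq> 0" if "j' < n" "?p j' > 0" for j' using pos[of j'] that by (cases "j' = j") auto
    show "?p j' \<le> n + 2" if "j' < n" for j' using bound[OF that] cap by simp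
  qed (use 1 2 in blast)+
qed

text \<open>Each bid raises the sum of prices by one, so this bounds the number of bids.\<close>

lemma auction_price_sum_le:
  assumes "auction_inv n R p own mate"
  shows "(\<Sum>j<n. p j) \<le> n * (n + 2)"
  using sum_bounded_above[of "{..<n}" p "n + 2"] assms by (simp add: auction_inv_def)

lemma auction_matching:
  assumes "auction_inv n R p own mate"
  shows "partial_matching {..<n} R (\<lambda>i. mate i - 1) {i. i < n \<and> mate i \<noteq> 0}"
proof -
  have *: "mate i - 1 < n \<and> own (mate i - 1) = Suc i \<and> R i (mate i - 1)" if "i < n" "mate i \<noteq> 0" for i
  proof -
    have a: "mate i - 1 < n" "own (mate i - 1) = Suc i"
      using assms that by (auto simp: auction_inv_def)
    then have "own (mate i - 1) \<noteq> 0" by simp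
    then have "R (own (mate i - 1) - 1) (mate i - 1)" using assms a(1) unfolding auction_inv_def by blast
    then show ?thesis using a by simp
  qed
  have "inj_on (\<lambda>i. mate i - 1) {i. i < n \<and> mate i \<noteq> 0}"
    by (rule inj_onI) (use * in \<open>metis (mono_tags, lifting) mem_Collect_eq Suc_inject\<close>)
  then show ?thesis using * by (auto simp: partial_matching_def)
qed

text \<open>Some price \<open>l \<in> {1..n + 1}\<close> is not taken. As matched vertices own an almost cheapest
  neighbour, the owners of right vertices that cost more than \<open>l\<close> have only such neighbours.\<close>

lemma auction_koenig:
  assumes inv: "auction_inv n R p own mate" and stuck: "\<And>i. i < n \<Longrightarrow> stuck n R p mate i"
  obtains X where "X \<subseteq> {..<n}"
    "card {j. j < n \<and> (\<exists>i\<in>X. R i j)} + card {i. i < n \<and> mate i = 0} \<le> card X"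
proof -
  \<comment> \<open>There are \<open>n + 1\<close> values but only \<open>n\<close> prices.\<close>
  have "\<not> {1..n + 1} \<subseteq> p ` {..<n}"
    using card_mono[of "p ` {..<n}" "{1..n + 1}"] card_image_le[of "{..<n}" p] by auto
  then obtain l where l: "1 \<le> l" "l \<le> n + 1" "\<And>j. j < n \<Longrightarrow> p j \<noteq> l" by fastforce
  \<comment> \<open>The certificate is \<open>?O \<union> ?U\<close>: the owners of the expensive
    right vertices and the unmatched left vertices, all of whose neighbours lie in
    \<open>?Y\<close>.\<close>
  let ?Y = "{j. j < n \<and> p j > l}" and ?U = "{i. i < n \<and> mate i = 0}"
  let ?O = "(\<lambda>j. own j - 1) ` ?Y"
  have own: "own j \<noteq> 0 \<and> own j - 1 < n \<and> mate (own j - 1) = Suc j \<and>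
      (\<forall>k<n. R (own j - 1) k \<longrightarrow> p j \<le> p k + 1)" if "j \<in> ?Y" for j
  proof -
    have "own j \<noteq> 0" using that inv l by (auto simp: auction_inv_def)
    then show ?thesis using that inv by (auto simp: auction_inv_def)
  qed
  have "inj_on (\<lambda>j. own j - 1) ?Y"
    by (rule inj_onI) (use own in \<open>metis Suc_inject\<close>)
  then have "card ?O = card ?Y" by (rule card_image)
  moreover have "?O \<inter> ?U = {}" using own by fastforce
  ultimately have card: "card (?O \<union> ?U) = card ?Y + card ?U" by (subst card_Un_disjoint) auto
  have "{j. j < n \<and> (\<exists>i\<in>?O \<union> ?U. R i j)} \<subseteq> ?Y"
  proof
    fix j assume "j \<in> {j. j < n \<and> (\<exists>i\<in>?O \<union> ?U. R i j)}"
    then obtain i where i: "i \<in> ?O \<union> ?U" "R i j" and j: "j < n" by blast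
    from i(1) show "j \<in> ?Y"
    proof
      assume "i \<in> ?O"
      then obtain k where k: "k \<in> ?Y" "i = own k - 1" by blast
      then have "p k \<le> p j + 1" using own[OF k(1)] i(2) j by blast
      then have "p j \<ge> l" using k(1) by simp
      then show ?thesis using l(3)[OF j] j by simp
    next
      assume "i \<in> ?U"
      \<comment> \<open>The cap was chosen to exceed every possible value of
        \<open>l\<close>.\<close>
      then have "p j \<ge> n + 2" using stuck[of i] i(2) j by (auto simp: stuck_def)
      then show ?thesis using l(2) j by simp
    qed
  qed
  then have "card {j. j < n \<and> (\<exists>i\<in>?O \<union> ?U. R i j)} \<le> card ?Y" by (intro card_mono) auto
  moreover have "?O \<union> ?U \<subseteq> {..<n}" using own by auto
  ultimately show ?thesis using that[of "?O \<union> ?U"] card by linarith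
qed

section \<open>Koenig duality and the formula for \<open>edge_add\<close>\<close>

text \<open>Weak duality: the matched part of \<open>X\<close> is mapped injectively into the
  neighbourhood of \<open>X\<close>.\<close>

lemma partial_matching_koenig_bound:
  assumes "finite V" "partial_matching V R f D" "X \<subseteq> V"
  shows "card D + card X \<le> card V + card {v \<in> V. \<exists>u\<in>X. R u v}"
proof -
  let ?N = "{v \<in> V. \<exists>u\<in>X. R u v}"
  have D: "D \<subseteq> V" "inj_on f D" "f ` D \<subseteq> V" "\<forall>x\<in>D. R x (f x)" and fin: "finite D" "finite X"
    using assms finite_subset by (auto simp: partial_matching_def)
  have "card (D \<inter> X) = card (f ` (D \<inter> X))"
    by (rule card_image[symmetric]) (use D(2) inj_on_subset in blast)
  also have "\<dots> \<le> card ?N" by (rule card_mono) (use D assms(1) in auto)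
  finally have "card (D \<inter> X) \<le> card ?N" .
  moreover have "card (D \<union> X) + card (D \<inter> X) = card D + card X" using card_Un_Int[OF fin] by simp
  moreover have "card (D \<union> X) \<le> card V" using D assms by (intro card_mono) auto
  ultimately show ?thesis by linarith
qed

lemma auction_matching_number:
  assumes inv: "auction_inv n R p own mate" and stuck: "\<And>i. i < n \<Longrightarrow> stuck n R p mate i"
  shows "matching_number {..<n} R + card {i. i < n \<and> mate i = 0} = n"
proof -
  let ?D = "{i. i < n \<and> mate i \<noteq> 0}" and ?U = "{i. i < n \<and> mate i = 0}"
  have n: "card ?D + card ?U = n"
  proof -
    have "?D \<union> ?U = {..<n}" by auto
    moreover have "?D \<inter> ?U = {}" by auto
    ultimately show ?thesis using card_Un_disjoint[of ?D ?U] by simp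
  qed
  obtain X where X: "X \<subseteq> {..<n}" "card {j. j < n \<and> (\<exists>i\<in>X. R i j)} + card ?U \<le> card X"
    using auction_koenig[OF assms] .
  have "matching_number {..<n} R = card ?D"
  proof (rule matching_number_eqI[OF _ auction_matching[OF inv]])
    show "card D \<le> card ?D" if "partial_matching {..<n} R f D" for f D
      using partial_matching_koenig_bound[OF _ that X(1)] X(2) n by simp
  qed simp
  then show ?thesis using n by simp
qed

text \<open>A state with maximal sum of prices is terminal, since any vertex that is not stuck could
  make a bid and increase the sum.\<close>

lemma auction_terminates:
  obtains p own mate where "auction_inv n R p own mate" "\<And>i. i < n \<Longrightarrow> stuck n R p mate i"
proof -
  let ?S = "{s. \<exists>p own mate. auction_inv n R p own mate \<and> s = (\<Sum>j<n. p j)}"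
  have "finite ?S" using auction_price_sum_le by (intro finite_subset[of ?S "{..n * (n + 2)}"]) auto
  moreover have "?S \<noteq> {}" using auction_inv_init by blast
  ultimately obtain p own mate where inv: "auction_inv n R p own mate"
    and max: "\<And>p' own' mate'. auction_inv n R p' own' mate' \<Longrightarrow> (\<Sum>j<n. p' j) \<le> (\<Sum>j<n. p j)"
    using Max_in[of ?S] Max_ge[of ?S] by (smt (verit, best) mem_Collect_eq)
  have "stuck n R p mate i" if i: "i < n" for i
  proof (rule ccontr)
    assume "\<not> ?thesis"
    then obtain k where k: "mate i = 0" "k < n" "R i k" "p k < n + 2" by (auto simp: stuck_def)
    obtain j where j: "j < n" "R i j" "\<And>k. k < n \<Longrightarrow> R i k \<Longrightarrow> p j \<le> p k"
      using ex_has_least_nat[of "\<lambda>j. j < n \<and> R i j" k p] k by auto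
    have "p j \<le> n + 1" using j(3)[OF k(2,3)] k(4) by simp
    from max[OF auction_inv_bid[OF inv i k(1) j this]]
    have "(\<Sum>k<n. (p(j := Suc (p j))) k) \<le> (\<Sum>k<n. p k)" .
    moreover have "(\<Sum>k<n. (p(j := Suc (p j))) k) > (\<Sum>k<n. p k)"
      by (rule sum_strict_mono_ex1) (use j(1) in auto)
    ultimately show False by simp
  qed
  then show ?thesis using that inv by blast
qed

lemma koenig:
  assumes V: "finite V"
  obtains X where "X \<subseteq> V" "card {v \<in> V. \<exists>u\<in>X. R u v} + card V \<le> card X + matching_number V R"
proof -
  obtain h where h: "bij_betw h {..<card V} V"
    using ex_bij_betw_nat_finite[OF V] by (auto simp: atLeast0LessThan)
  let ?n = "card V" and ?R = "\<lambda>i j. R (h i) (h j)"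
  have inj: "inj_on h {..<?n}" and im: "h ` {..<?n} = V" using h by (auto simp: bij_betw_def)
  obtain p own mate where a: "auction_inv ?n ?R p own mate" "\<And>i. i < ?n \<Longrightarrow> stuck ?n ?R p mate i"
    using auction_terminates[of ?n ?R] by blast
  obtain X where X: "X \<subseteq> {..<?n}"
    "card {j. j < ?n \<and> (\<exists>i\<in>X. ?R i j)} + card {i. i < ?n \<and> mate i = 0} \<le> card X"
    using auction_koenig[OF a] .
  have "matching_number {..<?n} ?R = matching_number V R"
    by (rule matching_number_transfer[OF V h]) simp
  then have "matching_number V R + card {i. i < ?n \<and> mate i = 0} = ?n"
    using auction_matching_number[OF a] by simp
  moreover have "card (h ` X) = card X" using inj X(1) by (meson card_image inj_on_subset)
  moreover have "card {v \<in> V. \<exists>u\<in>h ` X. R u v} = card {j. j < ?n \<and> (\<exists>i\<in>X. ?R i j)}"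
  proof -
    have "{v \<in> h ` {..<?n}. \<exists>u\<in>h ` X. R u v} = h ` {j. j < ?n \<and> (\<exists>i\<in>X. ?R i j)}"
      by auto
    then have "{v \<in> V. \<exists>u\<in>h ` X. R u v} = h ` {j. j < ?n \<and> (\<exists>i\<in>X. ?R i j)}"
      unfolding im .
    moreover have "inj_on h {j. j < ?n \<and> (\<exists>i\<in>X. ?R i j)}" by (rule inj_on_subset[OF inj]) auto
    ultimately show ?thesis by (simp add: card_image)
  qed
  ultimately show ?thesis using that[of "h ` X"] X im by fastforce
qed

text \<open>Hall's inequality for the set \<open>X\<close> of a Koenig certificate leaves no
  deficiency, so a maximum permutation covers \<open>V\<close>.\<close>

lemma permutation_of_perfect_2_matching:
  assumes G: "loop_graph V E" and x: "perfect_2_matching V E x"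
  obtains f where "permutes_along V E f"
proof -
  have V: "finite V" using G by (simp add: loop_graph_def)
  obtain X where X: "X \<subseteq> V"
    "card {v \<in> V. \<exists>u\<in>X. adjacent E u v} + card V \<le> card X + matching_number V (adjacent E)"
    using koenig[OF V] .
  have "card V \<le> matching_number V (adjacent E)"
    using perfect_2_matching_hall[OF G x X(1)] X(2) by (simp add: adjacent_def)
  moreover obtain S g where S: "S \<subseteq> V" "permutes_along S E g" "card S = matching_number V (adjacent E)"
    using maximum_permutation[OF V] .
  ultimately have "S = V" using V by (metis card_seteq)
  then show ?thesis using S that by blast
qed

theorem edge_add_eq:
  fixes V :: "'a set"
  assumes G: "loop_graph V E" and d: "matching_number V (adjacent E) + d = card V"
  shows "edge_add V E =
    (if even d then enat (d div 2)
     else if \<exists>u\<in>V. \<exists>v\<in>V. {u, v} \<in> E \<and> card V \<le> matching_number V (without u (adjacent E)) + d + 1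
       then enat (d div 2 + 1)
     else if card V = 1 then \<infinity> else enat (d div 2 + 2))" (is "_ = ?r")
proof (rule antisym)
  have d': "card V - matching_number V (adjacent E) = d" using d by simp
  note upper = edge_add_le_even[OF G] edge_add_le_odd_special[OF G] edge_add_le_odd[OF G]
    and lower = new_edges_ge[OF G] odd_few_new_edges[OF G]
  show "edge_add V E \<le> ?r" using upper[unfolded d'] by auto
  show "?r \<le> edge_add V E" unfolding edge_add_def
  proof (rule INF_greatest)
    fix F assume "F \<in> {F. edge_add_feasible V E F}"
    then have F: "F \<subseteq> pairs V" and x: "\<exists>x. perfect_2_matching V (E \<union> F) x"
      by (auto simp: edge_add_feasible_def loopless_non_edges_def pairs_def)
    obtain f where f: "permutes_along V (E \<union> F) f"
      using permutation_of_perfect_2_matching[OF loop_graph_Un_pairs[OF G F]] x by blast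
    have c: "d \<le> 2 * card F" using lower(1)[OF f F] by (simp add: d')
    show "?r \<le> enat (card F)"
    \<comment> \<open>For odd \<open>d\<close>, a larger \<open>F\<close> already has
      \<open>d div 2 + 2\<close> edges, the largest finite value of \<open>?r\<close>.\<close>
    proof (cases "odd d \<and> card F \<le> d div 2 + 1")
      case True
      then have "\<exists>u\<in>V. \<exists>v\<in>V. {u, v} \<in> E \<and> card V \<le> matching_number V (without u (adjacent E)) + d + 1"
        using lower(2)[OF f F, unfolded d'] by blast
      moreover have "d div 2 + 1 \<le> card F" using c True by presburger
      ultimately show ?thesis using True by simp
    next
      case False
      \<comment> \<open>The infinite case: a single vertex admits no pair, so \<open>F\<close> would
        be empty, although a positive \<open>d\<close> requires new arcs.\<close>
      moreover have "card V \<noteq> 1" if "odd d"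
      proof
        assume "card V = 1"
        then have "pairs V = {}"
          unfolding pairs_def by (auto simp: card_1_singleton_iff dest: card_mono[rotated])
        then show False using F c that by auto
      qed
      ultimately show ?thesis using c by auto
    qed
  qed
qed

section \<open>Loop programs with arrays\<close>

type_synonym store = "nat \<Rightarrow> nat \<Rightarrow> nat"

datatype aexp = Const nat | Arr nat aexp | Plus aexp aexp | Minus aexp aexp

text \<open>\<open>Loop v k c\<close> runs \<open>c\<close> for the values \<open>0, \<dots>, n + k - 1\<close> of entry 0 of array \<open>v\<close>, where \<open>n\<close> is
  entry 0 of array 0. As no program writes to array 0, the running time is a polynomial in \<open>n\<close>.\<close>

datatype cmd = Nop | Assign nat aexp aexp | Then cmd cmd | Cond aexp cmd cmd | Loop nat nat cmd

primrec aval :: "aexp \<Rightarrow> store \<Rightarrow> nat" where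
  "aval (Const k) s = k"
| "aval (Arr a e) s = s a (aval e s)"
| "aval (Plus d e) s = aval d s + aval e s"
| "aval (Minus d e) s = aval d s - aval e s"

definition put :: "nat \<Rightarrow> nat \<Rightarrow> nat \<Rightarrow> store \<Rightarrow> store" where
  "put a i x s = s(a := (s a)(i := x))"

primrec exec :: "cmd \<Rightarrow> store \<Rightarrow> store" where
  "exec Nop s = s"
| "exec (Assign a i e) s = put a (aval i s) (aval e s) s"
| "exec (Then c c') s = exec c' (exec c s)"
| "exec (Cond b c c') s = (if aval b s \<noteq> 0 then exec c s else exec c' s)"
| "exec (Loop v k c) s =
    ((\<lambda>t. put v 0 (Suc (exec c t v 0)) (exec c t)) ^^ (s 0 0 + k)) (put v 0 0 s)"

declare exec.simps(5) [simp del]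

primrec writes :: "cmd \<Rightarrow> nat set" where
  "writes Nop = {}"
| "writes (Assign a i e) = {a}"
| "writes (Then c c') = writes c \<union> writes c'"
| "writes (Cond b c c') = writes c \<union> writes c'"
| "writes (Loop v k c) = insert v (writes c)"

primrec aexp_ok :: "aexp \<Rightarrow> bool" where
  "aexp_ok (Const k) \<longleftrightarrow> True"
| "aexp_ok (Arr a e) \<longleftrightarrow> a < 32 \<and> aexp_ok e"
| "aexp_ok (Plus d e) \<longleftrightarrow> aexp_ok d \<and> aexp_ok e"
| "aexp_ok (Minus d e) \<longleftrightarrow> aexp_ok d \<and> aexp_ok e"

text \<open>The counter must survive the body of its loop: compiled code tests the counter before
  every pass, whereas \<open>exec\<close> fixes the number of passes in advance.\<close>

primrec cmd_ok :: "cmd \<Rightarrow> bool" where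
  "cmd_ok Nop \<longleftrightarrow> True"
| "cmd_ok (Assign a i e) \<longleftrightarrow> a \<noteq> 0 \<and> a < 32 \<and> aexp_ok i \<and> aexp_ok e"
| "cmd_ok (Then c c') \<longleftrightarrow> cmd_ok c \<and> cmd_ok c'"
| "cmd_ok (Cond b c c') \<longleftrightarrow> aexp_ok b \<and> cmd_ok c \<and> cmd_ok c'"
| "cmd_ok (Loop v k c) \<longleftrightarrow> v \<noteq> 0 \<and> v < 32 \<and> v \<notin> writes c \<and> cmd_ok c"

lemma put_same [simp]: "put a i x s a = (s a)(i := x)"
  by (simp add: put_def)

lemma put_frame [simp]: "b \<noteq> a \<Longrightarrow> put a i x s b = s b"
  by (simp add: put_def)

lemma exec_frame: "a \<notin> writes c \<Longrightarrow> exec c s a = s a"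
proof (induction c arbitrary: s)
  case (Loop v k c)
  have "((\<lambda>t. put v 0 (Suc (exec c t v 0)) (exec c t)) ^^ r) t a = t a" for r t
    by (induction r) (use Loop in auto)
  then show ?case using Loop.prems by (simp add: exec.simps(5))
qed auto

lemma cmd_ok_writes: "cmd_ok c \<Longrightarrow> 0 \<notin> writes c"
  by (induction c) auto

lemma exec_Loop_induct:
  assumes v: "v \<notin> writes c"
    and init: "P 0 (put v 0 0 s)"
    and step: "\<And>i t. i < s 0 0 + k \<Longrightarrow> P i t \<Longrightarrow> t v 0 = i \<Longrightarrow> P (Suc i) (put v 0 (Suc i) (exec c t))"
  shows "P (s 0 0 + k) (exec (Loop v k c) s)"
proof -
  let ?f = "\<lambda>t. put v 0 (Suc (exec c t v 0)) (exec c t)"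
  have "r \<le> s 0 0 + k \<Longrightarrow> P r ((?f ^^ r) (put v 0 0 s)) \<and> (?f ^^ r) (put v 0 0 s) v 0 = r" for r
  proof (induction r)
    case (Suc r)
    let ?t = "(?f ^^ r) (put v 0 0 s)"
    have "P r ?t" "?t v 0 = r" using Suc by auto
    moreover from this have "exec c ?t v 0 = r" using exec_frame[OF v] by simp
    ultimately show ?case using step[of r ?t] Suc.prems by simp
  qed (use init in simp)
  then show ?thesis by (simp add: exec.simps(5))
qed

section \<open>Simulation of loop programs on the machine\<close>

definition array_view :: "mem \<Rightarrow> store" where
  "array_view m a i = m (32 * i + a)"

text \<open>The arrays are interleaved because their lengths are unknown at compile time. The stride
  32 is a power of two, so that addresses are obtained by doubling, and it leaves room for the 18
  arrays in use.\<close>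

definition represents :: "mem \<Rightarrow> store \<Rightarrow> bool" where
  "represents m s \<longleftrightarrow> (\<forall>a<32. \<forall>i. m (32 * i + a) = s a i)"

definition double :: "exp \<Rightarrow> exp" where
  "double e = Add e e"

text \<open>Each doubling duplicates the expression. An index thus becomes about 32 times as
  expensive per nesting level, which is still a constant of the program.\<close>

definition cell :: "nat \<Rightarrow> exp \<Rightarrow> exp" where
  "cell a e = Add (double (double (double (double (double e))))) (Num a)"

primrec compile_aexp :: "aexp \<Rightarrow> exp" where
  "compile_aexp (Const k) = Num k"
| "compile_aexp (Arr a e) = Mem (cell a (compile_aexp e))"
| "compile_aexp (Plus d e) = Add (compile_aexp d) (compile_aexp e)"
| "compile_aexp (Minus d e) = Sub (compile_aexp d) (compile_aexp e)"

primrec compile :: "cmd \<Rightarrow> prog" where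
  "compile Nop = Skip"
| "compile (Assign a i e) = Store (cell a (compile_aexp i)) (compile_aexp e)"
| "compile (Then c c') = Seq (compile c) (compile c')"
| "compile (Cond b c c') = IfElse (compile_aexp b) (compile c) (compile c')"
| "compile (Loop v k c) = Seq (Store (Num v) (Num 0))
    (While (Sub (Add (Mem (Num 0)) (Num k)) (Mem (Num v)))
      (Seq (compile c) (Store (Num v) (Add (Mem (Num v)) (Num 1)))))"

text \<open>A loop pays 3 for clearing its counter and 8 for the last test; each pass pays 8 for a
  test and 6 for the increment. A conditional is charged for both branches.\<close>

primrec cost :: "cmd \<Rightarrow> nat poly" where
  "cost Nop = [:1:]"
| "cost (Assign a i e) = [:exp_cost (cell a (compile_aexp i)) + exp_cost (compile_aexp e) + 1:]"
| "cost (Then c c') = cost c + cost c'"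
| "cost (Cond b c c') = [:exp_cost (compile_aexp b) + 1:] + cost c + cost c'"
| "cost (Loop v k c) = [:11:] + [:k, 1:] * ([:14:] + cost c)"

lemma exp_val_cell [simp]: "exp_val (cell a e) m = 32 * exp_val e m + a"
  by (simp add: cell_def double_def)

lemma represents_array_view: "represents m (array_view m)"
  by (simp add: represents_def array_view_def)

lemma represents_cell0: "represents m s \<Longrightarrow> a < 32 \<Longrightarrow> m a = s a 0"
  unfolding represents_def by (metis add_0 mult_0_right)

lemma represents_put:
  assumes "represents m s" "a < 32"
  shows "represents (m(32 * i + a := x)) (put a i x s)"
proof -
  have "32 * j + b = 32 * i + a \<longleftrightarrow> j = i \<and> b = a" if "b < 32" for j b :: nat
  proof -
    have "(32 * j + b) div 32 = j" "(32 * j + b) mod 32 = b" "(32 * i + a) div 32 = i" "(32 * i + a) mod 32 = a"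
      using assms(2) that by simp_all
    then show ?thesis by metis
  qed
  then show ?thesis using assms by (auto simp: represents_def put_def)
qed

lemma compile_aexp_correct:
  "aexp_ok e \<Longrightarrow> represents m s \<Longrightarrow> exp_val (compile_aexp e) m = aval e s"
  by (induction e) (auto simp: represents_def)

lemma runs_StoreI:
  "a = exp_val d m \<Longrightarrow> x = exp_val e m \<Longrightarrow> t = exp_cost d + exp_cost e + 1 \<Longrightarrow>
    runs (Store d e) m t (m(a := x))"
  using runs.Store by simp

lemma compile_correct:
  "cmd_ok c \<Longrightarrow> represents m s \<Longrightarrow>
    \<exists>t m'. runs (compile c) m t m' \<and> represents m' (exec c s) \<and> t \<le> poly (cost c) (s 0 0)"
proof (induction c arbitrary: m s)
  case Nop
  then show ?case using runs.Skip by fastforce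
next
  case (Assign a i e)
  let ?t = "exp_cost (cell a (compile_aexp i)) + exp_cost (compile_aexp e) + 1"
  have "runs (compile (Assign a i e)) m ?t (m(32 * aval i s + a := aval e s))"
    unfolding compile.simps
    by (rule runs_StoreI) (use Assign compile_aexp_correct in auto)
  then show ?case using represents_put Assign by fastforce
next
  case (Then c c')
  from Then.IH(1)[of m s] Then.prems obtain t m' where
    1: "runs (compile c) m t m'" "represents m' (exec c s)" "t \<le> poly (cost c) (s 0 0)" by auto
  from Then.IH(2)[of m' "exec c s"] Then.prems 1 obtain t' m'' where
    2: "runs (compile c') m' t' m''" "represents m'' (exec c' (exec c s))"
      "t' \<le> poly (cost c') (exec c s 0 0)" by auto
  have "exec c s 0 = s 0" using Then.prems by (intro exec_frame cmd_ok_writes) auto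
  then show ?case using 1 2 runs.Seq[OF 1(1) 2(1)]
    by (intro exI[of _ "t + t'"] exI[of _ m'']) auto
next
  case (Cond b c c')
  have b: "exp_val (compile_aexp b) m = aval b s" using Cond.prems compile_aexp_correct by auto
  show ?case
  proof (cases "aval b s = 0")
    case True
    from Cond.IH(2)[of m s] Cond.prems obtain t m' where
      "runs (compile c') m t m'" "represents m' (exec c' s)" "t \<le> poly (cost c') (s 0 0)" by auto
    then show ?thesis using True b runs.IfFalse[of "compile_aexp b" m "compile c'" t m' "compile c"]
      by (intro exI[of _ "exp_cost (compile_aexp b) + 1 + t"] exI[of _ m']) auto
  next
    case False
    from Cond.IH(1)[of m s] Cond.prems obtain t m' where
      "runs (compile c) m t m'" "represents m' (exec c s)" "t \<le> poly (cost c) (s 0 0)" by auto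
    then show ?thesis using False b runs.IfTrue[of "compile_aexp b" m "compile c" t m' "compile c'"]
      by (intro exI[of _ "exp_cost (compile_aexp b) + 1 + t"] exI[of _ m']) auto
  qed
next
  case (Loop v k c)
  let ?b = "Sub (Add (Mem (Num 0)) (Num k)) (Mem (Num v))"
    and ?inc = "Store (Num v) (Add (Mem (Num v)) (Num 1))"
    and ?f = "\<lambda>t. put v 0 (Suc (exec c t v 0)) (exec c t)"
  have v: "v < 32" "v \<noteq> 0" "v \<notin> writes c" and c: "cmd_ok c" using Loop.prems by auto
  \<comment> \<open>Generalised over the number \<open>r\<close> of remaining passes; the cut-off
    difference in the test equals \<open>r\<close>.\<close>
  have while: "\<exists>t m'. runs (While ?b (Seq (compile c) ?inc)) m t m' \<and> represents m' ((?f ^^ r) s) \<and>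
      t \<le> 8 + r * (14 + poly (cost c) (s 0 0))"
    if "represents m s" "s v 0 + r = s 0 0 + k" for r m s
    using that
  proof (induction r arbitrary: m s)
    case 0
    then have "exp_val ?b m = 0" using represents_cell0[of m s] v by simp
    from runs.WhileFalse[OF this] 0 show ?case by (intro exI[of _ 8] exI[of _ m]) (simp add: eval_nat_numeral)
  next
    case (Suc r)
    have b: "exp_val ?b m \<noteq> 0" using represents_cell0[of m s] v Suc.prems by simp
    from Loop.IH[OF c Suc.prems(1)] obtain t m' where
      1: "runs (compile c) m t m'" "represents m' (exec c s)" "t \<le> poly (cost c) (s 0 0)" by blast
    have fr: "exec c s 0 = s 0" "exec c s v = s v"
      using exec_frame[OF cmd_ok_writes[OF c]] exec_frame[OF v(3)] by blast+
    have 2: "runs ?inc m' 6 (m'(v := Suc (exec c s v 0)))"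
      by (rule runs_StoreI) (use represents_cell0[OF 1(2) v(1)] in auto)
    have 3: "represents (m'(v := Suc (exec c s v 0))) (?f s)"
      using represents_put[OF 1(2) v(1), of 0] by simp
    have "?f s v 0 + r = ?f s 0 0 + k" using Suc.prems(2) v fr by simp
    from Suc.IH[OF 3 this] obtain t' m'' where 4: "runs (While ?b (Seq (compile c) ?inc)) (m'(v := Suc (exec c s v 0))) t' m''"
      "represents m'' ((?f ^^ r) (?f s))" "t' \<le> 8 + r * (14 + poly (cost c) (?f s 0 0))"
      by blast
    have "?f s 0 0 = s 0 0" using fr v by simp
    then have "exp_cost ?b + 1 + (t + 6) + t' \<le> 8 + Suc r * (14 + poly (cost c) (s 0 0))"
      using 1(3) 4(3) by simp
    moreover have "(?f ^^ Suc r) s = (?f ^^ r) (?f s)" by (simp only: funpow_Suc_right o_apply)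
    ultimately show ?case
      using runs.WhileTrue[OF b runs.Seq[OF 1(1) 2] 4(1)] 4(2) by (metis (no_types, lifting))
  qed
  have init: "represents (m(v := 0)) (put v 0 0 s)"
    using represents_put[OF Loop.prems(2) v(1), of 0 0] by simp
  have "put v 0 0 s v 0 + (s 0 0 + k) = put v 0 0 s 0 0 + k" using v(2) by simp
  from while[OF init this] obtain t m' where
    w: "runs (While ?b (Seq (compile c) ?inc)) (m(v := 0)) t m'"
      "represents m' ((?f ^^ (s 0 0 + k)) (put v 0 0 s))"
      "t \<le> 8 + (s 0 0 + k) * (14 + poly (cost c) (put v 0 0 s 0 0))" by blast
  have "runs (Store (Num v) (Num 0)) m 3 (m(v := 0))" by (rule runs_StoreI) auto
  from runs.Seq[OF this w(1)] have "runs (compile (Loop v k c)) m (3 + t) m'" by simp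
  moreover have "3 + t \<le> poly (cost (Loop v k c)) (s 0 0)"
    using w(3) v(2) by (simp add: algebra_simps)
  ultimately show ?case using w(2) unfolding exec.simps(5) by blast
qed

section \<open>The algorithm as a loop program\<close>

abbreviation (input) "arRes \<equiv> 1 :: nat"
abbreviation (input) "arFin \<equiv> 2 :: nat"
abbreviation (input) "arAdj \<equiv> 3 :: nat"
abbreviation (input) "arRow \<equiv> 4 :: nat"
abbreviation (input) "arPrice \<equiv> 5 :: nat"
abbreviation (input) "arOwn \<equiv> 6 :: nat"
abbreviation (input) "arMate \<equiv> 7 :: nat"
abbreviation (input) "arDef \<equiv> 8 :: nat"
abbreviation (input) "arU \<equiv> 9 :: nat"
abbreviation (input) "arA \<equiv> 10 :: nat"
abbreviation (input) "arB \<equiv> 11 :: nat"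
abbreviation (input) "arI \<equiv> 12 :: nat"
abbreviation (input) "arJ \<equiv> 13 :: nat"
abbreviation (input) "arBest \<equiv> 14 :: nat"
abbreviation (input) "arRem \<equiv> 15 :: nat"
abbreviation (input) "arHalf \<equiv> 16 :: nat"
abbreviation (input) "arFlag \<equiv> 17 :: nat"

abbreviation (input) "Var a \<equiv> Arr a (Const 0)"
abbreviation (input) "Set a e \<equiv> Assign a (Const 0) e"
abbreviation (input) "Pred e \<equiv> Minus e (Const 1)"
text \<open>\<open>Differ\<close> in the next line relies on cut-off subtraction: one of the two
  differences is nonzero exactly if the values differ.\<close>

abbreviation (input) "Incr e \<equiv> Plus e (Const 1)"
abbreviation (input) "Differ d e \<equiv> Plus (Minus d e) (Minus e d)"

section \<open>The state of the auction program\<close>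

definition adj :: "store \<Rightarrow> nat \<Rightarrow> nat \<Rightarrow> bool" where
  "adj s i j \<longleftrightarrow> s arAdj (s arRow i + j) \<noteq> 0"

definition rel :: "store \<Rightarrow> nat \<Rightarrow> nat \<Rightarrow> bool" where
  "rel s = without (s arU 0) (adj s)"

definition fixed :: "store \<Rightarrow> store \<Rightarrow> bool" where
  "fixed s t \<longleftrightarrow> t 0 = s 0 \<and> t arAdj = s arAdj \<and> t arRow = s arRow \<and> t arU = s arU"

definition same :: "store \<Rightarrow> store \<Rightarrow> bool" where
  "same s t \<longleftrightarrow> t arPrice = s arPrice \<and> t arOwn = s arOwn \<and> t arMate = s arMate"

definition core :: "store \<Rightarrow> bool" where
  "core s \<longleftrightarrow> auction_inv (s 0 0) (rel s) (s arPrice) (s arOwn) (s arMate)"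

definition stuck_at :: "store \<Rightarrow> nat \<Rightarrow> bool" where
  "stuck_at s = stuck (s 0 0) (rel s) (s arPrice) (s arMate)"

definition all_stuck :: "store \<Rightarrow> bool" where
  "all_stuck s \<longleftrightarrow> (\<forall>i<s 0 0. stuck_at s i)"

definition prices :: "store \<Rightarrow> nat" where
  "prices s = (\<Sum>j<s 0 0. s arPrice j)"

lemma adj_cong: "t arAdj = s arAdj \<Longrightarrow> t arRow = s arRow \<Longrightarrow> adj t = adj s"
  by (simp add: adj_def fun_eq_iff)

lemma fixed_rel: "fixed s t \<Longrightarrow> rel t = rel s"
  using adj_cong[of t s] by (simp add: fixed_def rel_def)

lemma fixed_same:
  assumes "fixed s t" "same s t"
  shows "core t = core s" "stuck_at t = stuck_at s" "all_stuck t = all_stuck s" "prices t = prices s"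
  using assms fixed_rel[OF assms(1)]
  by (simp_all add: fixed_def same_def core_def stuck_at_def all_stuck_def prices_def)

lemma fixed_refl: "fixed s s" by (simp add: fixed_def)

lemma fixed_trans: "fixed s t \<Longrightarrow> fixed t u \<Longrightarrow> fixed s u"
  by (simp add: fixed_def)

lemma fixed_exec: "writes c \<inter> {0, arAdj, arRow, arU} = {} \<Longrightarrow> fixed s (exec c s)"
  by (auto simp: fixed_def intro!: exec_frame)

lemma fixed_put: "a \<notin> {0, arAdj, arRow, arU} \<Longrightarrow> fixed s (put a i x s)"
  by (auto simp: fixed_def)

lemma same_put: "a \<notin> {arPrice, arOwn, arMate} \<Longrightarrow> same s (put a i x s)"
  by (auto simp: same_def)

definition consider_cmd :: cmd where
  "consider_cmd =
    Cond (Arr arAdj (Plus (Arr arRow (Var arI)) (Var arJ)))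
     (Cond (Differ (Var arI) (Var arU))
      (Cond (Differ (Var arJ) (Var arU))
       (Cond (Var arBest)
         (Cond (Minus (Arr arPrice (Pred (Var arBest))) (Arr arPrice (Var arJ)))
           (Set arBest (Incr (Var arJ))) Nop)
         (Set arBest (Incr (Var arJ)))) Nop) Nop) Nop"

definition scan_cmd :: cmd where
  "scan_cmd = Then (Set arBest (Const 0)) (Loop arJ 0 consider_cmd)"

text \<open>The displaced owner is released before \<open>arOwn\<close>, the only record of it, is
  overwritten.\<close>

definition accept_cmd :: cmd where
  "accept_cmd =
    Then (Cond (Arr arOwn (Pred (Var arBest))) (Assign arMate (Pred (Arr arOwn (Pred (Var arBest)))) (Const 0)) Nop)
   (Then (Assign arOwn (Pred (Var arBest)) (Incr (Var arI)))
   (Then (Assign arMate (Var arI) (Var arBest))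
     (Assign arPrice (Pred (Var arBest)) (Incr (Arr arPrice (Pred (Var arBest)))))))"

definition bid_cmd :: cmd where
  "bid_cmd = Cond (Arr arMate (Var arI)) Nop
    (Then scan_cmd
      (Cond (Var arBest)
        (Cond (Minus (Arr arPrice (Pred (Var arBest))) (Incr (Var 0))) Nop accept_cmd) Nop))"

text \<open>There are \<open>(n + 1) * (n + 1) = n * (n + 2) + 1\<close> rounds, one more than the
  largest possible sum of prices.\<close>

definition rounds_cmd :: cmd where
  "rounds_cmd = Loop arA 1 (Loop arB 1 (Loop arI 0 bid_cmd))"

definition matching_cmd :: cmd where
  "matching_cmd =
    Then (Loop arI 0 (Then (Assign arPrice (Var arI) (Const 0))
      (Then (Assign arOwn (Var arI) (Const 0)) (Assign arMate (Var arI) (Const 0)))))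
   (Then rounds_cmd
   (Then (Assign arDef (Var arU) (Const 0))
     (Loop arI 0 (Cond (Arr arMate (Var arI)) Nop
       (Assign arDef (Var arU) (Incr (Arr arDef (Var arU))))))))"

lemmas cmd_defs = consider_cmd_def scan_cmd_def accept_cmd_def bid_cmd_def rounds_cmd_def matching_cmd_def

lemma differ_eq_0: "(a - b) + (b - a) = 0 \<longleftrightarrow> a = (b :: nat)"
  by auto

text \<open>The candidate is shifted by one like \<open>own\<close> and \<open>mate\<close>; 0 means
  that no neighbour has been seen among the first \<open>r\<close> vertices.\<close>

definition best_of :: "store \<Rightarrow> nat \<Rightarrow> nat \<Rightarrow> nat \<Rightarrow> bool" where
  "best_of s i r b \<longleftrightarrow>
    (if b = 0 then \<forall>k<r. \<not> rel s i k
     else b \<le> r \<and> rel s i (b - 1) \<and> (\<forall>k<r. rel s i k \<longrightarrow> s arPrice (b - 1) \<le> s arPrice k))"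

lemma consider_best:
  "exec consider_cmd t arBest 0 =
    (if rel t (t arI 0) (t arJ 0) \<and> (t arBest 0 = 0 \<or> t arPrice (t arJ 0) < t arPrice (t arBest 0 - 1))
     then Suc (t arJ 0) else t arBest 0)"
proof -
  have "rel t (t arI 0) (t arJ 0) \<longleftrightarrow> t arAdj (t arRow (t arI 0) + t arJ 0) \<noteq> 0 \<and>
      t arI 0 \<noteq> t arU 0 \<and> t arJ 0 \<noteq> t arU 0"
    by (simp add: rel_def without_def adj_def)
  then show ?thesis unfolding consider_cmd_def exec.simps aval.simps differ_eq_0
    by (simp only: if_splits put_same fun_upd_same zero_less_diff) simp
qed

lemma scan_best: "best_of s (s arI 0) (s 0 0) (exec scan_cmd s arBest 0)"
proof -
  let ?s = "put arBest 0 0 s"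
  define P where "P r t \<longleftrightarrow> fixed s t \<and> t arI = s arI \<and> t arPrice = s arPrice \<and>
    best_of s (s arI 0) r (t arBest 0)" for r t
  have "P (?s 0 0 + 0) (exec (Loop arJ 0 consider_cmd) ?s)"
  proof (rule exec_Loop_induct)
    show "P 0 (put arJ 0 0 ?s)" by (simp add: P_def fixed_def best_of_def)
    fix r t assume r: "P r t" "t arJ 0 = r"
    let ?t = "put arJ 0 (Suc r) (exec consider_cmd t)"
    have "exec consider_cmd t a = t a" if "a \<noteq> arBest" for a
      by (rule exec_frame) (use that in \<open>simp add: consider_cmd_def\<close>)
    then have "fixed s ?t \<and> ?t arI = s arI \<and> ?t arPrice = s arPrice"
      using r by (simp add: P_def fixed_def)
    moreover have "rel t = rel s" using r fixed_rel[of s t] by (simp add: P_def)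
    then have "best_of s (s arI 0) (Suc r) (?t arBest 0)"
      using r by (auto simp: P_def best_of_def consider_best less_Suc_eq split: if_splits)
    ultimately show "P (Suc r) ?t" by (simp add: P_def)
  qed (simp add: consider_cmd_def)
  then show ?thesis by (simp add: P_def scan_cmd_def)
qed

lemma accept_arrays:
  assumes "s arBest 0 = Suc j" "s arI 0 = i"
  shows "exec accept_cmd s arPrice = (s arPrice)(j := Suc (s arPrice j))"
    "exec accept_cmd s arOwn = (s arOwn)(j := Suc i)"
    "exec accept_cmd s arMate =
      (if s arOwn j = 0 then s arMate else (s arMate)(s arOwn j - 1 := 0))(i := Suc j)"
proof -
  have 1: "s arBest 0 - 1 = j" using assms by simp
  show "exec accept_cmd s arPrice = (s arPrice)(j := Suc (s arPrice j))"
    "exec accept_cmd s arOwn = (s arOwn)(j := Suc i)"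
    unfolding accept_cmd_def exec.simps aval.simps 1 using assms by (simp_all del: fun_upd_apply add: 1)
  show "exec accept_cmd s arMate =
      (if s arOwn j = 0 then s arMate else (s arMate)(s arOwn j - 1 := 0))(i := Suc j)"
    unfolding accept_cmd_def exec.simps aval.simps 1 using assms by (simp del: fun_upd_apply add: 1)
qed

section \<open>Termination of the auction within the loop bounds\<close>

lemma bid_cmd:
  assumes core: "core s" and i: "s arI 0 = i" "i < s 0 0"
  shows "core (exec bid_cmd s)" "stuck_at s i \<Longrightarrow> same s (exec bid_cmd s)"
    "\<not> stuck_at s i \<Longrightarrow> prices s < prices (exec bid_cmd s)"
proof -
  let ?n = "s 0 0" and ?s = "exec scan_cmd s" and ?t = "exec bid_cmd s"
  have fix_t: "fixed s ?t" by (rule fixed_exec) (simp add: cmd_defs)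
  have scan: "?s a = s a" if "a \<notin> {arBest, arJ}" for a
    by (rule exec_frame) (use that in \<open>simp add: cmd_defs\<close>)
  have "same s ?s" by (simp add: same_def scan)
  have "core ?t \<and> (stuck_at s i \<longrightarrow> same s ?t) \<and> (\<not> stuck_at s i \<longrightarrow> prices s < prices ?t)"
  proof (cases "s arMate i \<noteq> 0")
    case True
    then have "?t = s" using i by (simp add: bid_cmd_def)
    moreover have "stuck_at s i" using True by (simp add: stuck_at_def stuck_def)
    ultimately show ?thesis using core by (simp add: same_def)
  next
    case unmatched: False
    have best: "best_of s i ?n (?s arBest 0)" using scan_best[of s] i by simp
    have t: "?t = (if ?s arBest 0 \<noteq> 0 \<and> s arPrice (?s arBest 0 - 1) \<le> ?n + 1 then exec accept_cmd ?s else ?s)"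
      using unmatched i scan by (simp add: bid_cmd_def)
    show ?thesis
    proof (cases "?s arBest 0 \<noteq> 0 \<and> s arPrice (?s arBest 0 - 1) \<le> ?n + 1")
      case True
      then obtain j where j: "?s arBest 0 = Suc j" by (cases "?s arBest 0") auto
      then have *: "j < ?n" "rel s i j" "\<And>k. k < ?n \<Longrightarrow> rel s i k \<Longrightarrow> s arPrice j \<le> s arPrice k"
        "s arPrice j \<le> ?n + 1" using best True by (auto simp: best_of_def)
      have "?t = exec accept_cmd ?s" using t True by simp
      then have arr: "?t arPrice = (s arPrice)(j := Suc (s arPrice j))" "?t arOwn = (s arOwn)(j := Suc i)"
        "?t arMate = (if s arOwn j = 0 then s arMate else (s arMate)(s arOwn j - 1 := 0))(i := Suc j)"
        using accept_arrays[of ?s j i] j scan i by auto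
      have n: "?t 0 = s 0" "rel ?t = rel s" using fix_t fixed_rel[OF fix_t] by (simp_all add: fixed_def)
      have "core ?t" unfolding core_def n arr
        by (rule auction_inv_bid) (use core unmatched i * in \<open>auto simp: core_def\<close>)
      moreover have "\<not> stuck_at s i" using * unmatched by (auto simp: stuck_at_def stuck_def intro!: exI[of _ j])
      moreover have "prices s < prices ?t" unfolding prices_def n arr
        by (rule sum_strict_mono_ex1) (use *(1) in auto)
      ultimately show ?thesis by simp
    next
      case False
      then have "?t = ?s" using t by (simp only: if_False simp_thms)
      moreover have "stuck_at s i"
      proof -
        have "s arPrice k \<ge> ?n + 2" if "k < ?n" "rel s i k" for k
        proof (cases "?s arBest 0 = 0")
          case True
          then show ?thesis using best that by (simp add: best_of_def)
        next
          case b: False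
          then have "s arPrice (?s arBest 0 - 1) \<le> s arPrice k" using best that by (simp add: best_of_def)
          then show ?thesis using False b by simp
        qed
        then show ?thesis by (simp add: stuck_at_def stuck_def)
      qed
      ultimately show ?thesis using \<open>same s ?s\<close> core fixed_same(1)[OF fix_t] by simp
    qed
  qed
  then show "core (exec bid_cmd s)" "stuck_at s i \<Longrightarrow> same s (exec bid_cmd s)"
    "\<not> stuck_at s i \<Longrightarrow> prices s < prices (exec bid_cmd s)" by auto
qed

text \<open>Either the auction is over or the sum of prices has grown by at least \<open>r\<close>.
  The clause \<open>\<not> all_stuck s\<close> makes a finished auction stay finished, so that gains
  add up under composition.\<close>

definition progress :: "nat \<Rightarrow> store \<Rightarrow> store \<Rightarrow> bool" where
  "progress r s t \<longleftrightarrow> fixed s t \<and> core t \<and> (all_stuck t \<or> \<not> all_stuck s \<and> prices s + r \<le> prices t)"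

lemma progress_trans: "progress q s t \<Longrightarrow> progress r t u \<Longrightarrow> progress (q + r) s u"
  using fixed_trans[of s t u] by (auto simp: progress_def)

lemma progress_put:
  assumes "progress r s t" "a \<notin> {0, arAdj, arRow, arU, arPrice, arOwn, arMate}"
  shows "progress r s (put a i x t)"
proof -
  have f: "fixed t (put a i x t)" and "same t (put a i x t)"
    using assms(2) by (auto intro: fixed_put same_put)
  from fixed_same[OF this] show ?thesis using assms(1) fixed_trans[OF _ f] by (auto simp: progress_def)
qed

text \<open>A bid may displace the partner of a vertex visited earlier in the round, so a visit
  alone settles nothing. But a round without bids keeps the auction state, and all its visits then
  testify about the same state; a round with a bid gains at least one.\<close>

lemma progress_round:
  assumes "core s"
  shows "progress 1 s (exec (Loop arI 0 bid_cmd) s)"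
proof -
  define P where "P r t \<longleftrightarrow> fixed s t \<and> core t \<and>
    (same s t \<and> (\<forall>i<r. stuck_at s i) \<or> \<not> all_stuck s \<and> prices s < prices t)" for r t
  have put: "P r (put arI 0 x t)" if "P r t" for r x t
  proof -
    have f: "fixed t (put arI 0 x t)" and sm: "same t (put arI 0 x t)"
      by (auto intro: fixed_put same_put)
    show ?thesis using that fixed_same[OF f sm] fixed_trans[OF _ f] sm by (auto simp: P_def same_def)
  qed
  have "P (s 0 0 + 0) (exec (Loop arI 0 bid_cmd) s)"
  proof (rule exec_Loop_induct)
    have "P 0 s" using assms by (simp add: P_def fixed_refl same_def)
    then show "P 0 (put arI 0 0 s)" by (rule put)
    fix r t assume r: "r < s 0 0 + 0" "P r t" "t arI 0 = r"
    have f: "fixed s t" "core t" using r by (auto simp: P_def)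
    then have r': "r < t 0 0" using r by (simp add: fixed_def)
    note b = bid_cmd[OF f(2) r(3) r']
    have f': "fixed s (exec bid_cmd t)"
      by (rule fixed_trans[OF f(1) fixed_exec]) (simp add: cmd_defs)
    have "P (Suc r) (exec bid_cmd t)"
    proof (cases "stuck_at t r")
      case True
      have "fixed t (exec bid_cmd t)" by (rule fixed_exec) (simp add: cmd_defs)
      note e = fixed_same[OF this b(2)[OF True]]
      have "\<forall>i<Suc r. stuck_at s i" if "same s t" "\<forall>i<r. stuck_at s i"
        using that fixed_same(2)[OF f(1)] True by (auto simp: less_Suc_eq)
      then show ?thesis using r(2) b(1) f' e b(2)[OF True] by (auto simp: P_def same_def)
    next
      case False
      have "\<not> all_stuck s \<and> prices s < prices (exec bid_cmd t)"
      proof (cases "same s t")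
        case True
        note e = fixed_same[OF f(1) True]
        have "\<not> all_stuck t" using False r' by (auto simp: all_stuck_def)
        then show ?thesis using e b(3)[OF False] by simp
      next
        case nsame: False
        then show ?thesis using r(2) b(3)[OF False] by (auto simp: P_def)
      qed
      then show ?thesis using b(1) f' by (simp add: P_def)
    qed
    then show "P (Suc r) (put arI 0 (Suc r) (exec bid_cmd t))" by (rule put)
  qed (simp add: cmd_defs)
  then have *: "P (s 0 0) (exec (Loop arI 0 bid_cmd) s)" by simp
  then have "all_stuck (exec (Loop arI 0 bid_cmd) s)"
    if "same s (exec (Loop arI 0 bid_cmd) s)" "\<forall>i<s 0 0. stuck_at s i"
    using fixed_same(3)[of s "exec (Loop arI 0 bid_cmd) s"] that by (simp add: P_def all_stuck_def)
  then show ?thesis using * by (auto simp: P_def progress_def)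
qed

lemma progress_Loop:
  assumes core: "core s" and body: "\<And>t. core t \<Longrightarrow> progress r t (exec c t)"
    and v: "v \<notin> writes c" "v \<notin> {0, arAdj, arRow, arU, arPrice, arOwn, arMate}"
  shows "progress ((s 0 0 + 1) * r) s (exec (Loop v 1 c) s)"
proof (rule exec_Loop_induct[where P = "\<lambda>i. progress (i * r) s"])
  show "progress (0 * r) s (put v 0 0 s)"
    by (rule progress_put) (use core v in \<open>auto simp: progress_def fixed_refl\<close>)
  fix i t assume "progress (i * r) s t"
  then have "progress (i * r + r) s (exec c t)"
    by (rule progress_trans[OF _ body]) (use \<open>progress (i * r) s t\<close> in \<open>simp add: progress_def\<close>)
  then have "progress (Suc i * r) s (exec c t)" by (simp add: add.commute)
  then show "progress (Suc i * r) s (put v 0 (Suc i) (exec c t))" by (rule progress_put) (use v in auto)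
qed (use v in simp)

lemma rounds_cmd:
  assumes "core s"
  shows "fixed s (exec rounds_cmd s)" "core (exec rounds_cmd s)" "all_stuck (exec rounds_cmd s)"
proof -
  let ?n = "s 0 0" and ?t = "exec rounds_cmd s"
  have inner: "progress (t 0 0 + 1) t (exec (Loop arB 1 (Loop arI 0 bid_cmd)) t)" if "core t" for t
  proof -
    have "progress ((t 0 0 + 1) * 1) t (exec (Loop arB 1 (Loop arI 0 bid_cmd)) t)"
    proof (rule progress_Loop[where s = t])
      show "core t" by (rule that)
      show "progress 1 t' (exec (Loop arI 0 bid_cmd) t')" if "core t'" for t'
        by (rule progress_round[OF that])
    qed (simp_all add: cmd_defs)
    then show ?thesis by (simp only: mult_1_right)
  qed
  define P where "P i t \<longleftrightarrow> progress (i * (?n + 1)) s t" for i t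
  have "P (s 0 0 + 1) (exec (Loop arA 1 (Loop arB 1 (Loop arI 0 bid_cmd))) s)"
  proof (rule exec_Loop_induct[where s = s and P = P])
    show "P 0 (put arA 0 0 s)" unfolding P_def
      by (rule progress_put) (use assms in \<open>auto simp: progress_def fixed_refl\<close>)
    fix i t assume "P i t"
    then have t: "progress (i * (?n + 1)) s t" "core t" "t 0 = s 0"
      by (auto simp: P_def progress_def fixed_def)
    have "progress (i * (?n + 1) + (?n + 1)) s (exec (Loop arB 1 (Loop arI 0 bid_cmd)) t)"
      using progress_trans[OF t(1) inner[OF t(2)]] t(3) by simp
    then have "progress (Suc i * (?n + 1)) s (exec (Loop arB 1 (Loop arI 0 bid_cmd)) t)"
      by (simp add: algebra_simps)
    then show "P (Suc i) (put arA 0 (Suc i) (exec (Loop arB 1 (Loop arI 0 bid_cmd)) t))"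
      unfolding P_def by (rule progress_put) auto
  qed (simp add: cmd_defs)
  then have p: "progress ((?n + 1) * (?n + 1)) s ?t" by (simp only: P_def rounds_cmd_def)
  then show "fixed s ?t" "core ?t" by (auto simp: progress_def)
  then have "prices ?t \<le> ?n * (?n + 2)"
    using auction_price_sum_le[of "?t 0 0"] by (simp add: core_def prices_def fixed_def)
  then show "all_stuck ?t" using p by (auto simp: progress_def)
qed


lemma card_less_Suc_filter:
  "card {i. i < Suc r \<and> Q i} = card {i. i < r \<and> Q i} + (if Q r then 1 else 0)"
proof -
  have "{i. i < Suc r \<and> Q i} = (if Q r then insert r {i. i < r \<and> Q i} else {i. i < r \<and> Q i})"
    by (auto simp: less_Suc_eq)
  then show ?thesis by simp
qed

lemma matching_cmd:
  fixes s
  defines "u \<equiv> s arU 0" and "n \<equiv> s 0 0" and "t \<equiv> exec matching_cmd s"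
  shows "fixed s t" "t arDef u + matching_number {..<n} (without u (adj s)) = n"
    "v \<noteq> u \<Longrightarrow> t arDef v = s arDef v"
proof -
  show "fixed s t" unfolding t_def by (rule fixed_exec) (simp add: cmd_defs)
  define clear where "clear = Loop arI 0 (Then (Assign arPrice (Var arI) (Const 0))
      (Then (Assign arOwn (Var arI) (Const 0)) (Assign arMate (Var arI) (Const 0))))"
  define count where "count = Loop arI 0 (Cond (Arr arMate (Var arI)) Nop
       (Assign arDef (Var arU) (Incr (Arr arDef (Var arU)))))"
  define s1 where "s1 = exec clear s"
  define s2 where "s2 = exec rounds_cmd s1"
  define s3 where "s3 = put arDef u 0 s2"
  define P where "P r t \<longleftrightarrow> (\<forall>i<r. t arPrice i = 0 \<and> t arOwn i = 0 \<and> t arMate i = 0)"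
    for r and t :: store
  have f1: "fixed s s1" unfolding s1_def by (rule fixed_exec) (simp add: clear_def)
  have d1: "s1 arDef = s arDef" unfolding s1_def by (rule exec_frame) (simp add: clear_def)
  have "P (s 0 0 + 0) (exec clear s)" unfolding clear_def
    by (rule exec_Loop_induct) (auto simp: P_def less_Suc_eq)
  \<comment> \<open>Clearing reaches only the entries below \<open>n\<close>; the others may hold
    arbitrary values.\<close>
  then have "core s1" using f1 unfolding core_def s1_def P_def fixed_def
    by (intro auction_inv_cong[OF auction_inv_init]) simp
  note rounds = rounds_cmd[OF this, folded s2_def]
  have f2: "fixed s s2" using fixed_trans[OF f1 rounds(1)] .
  have d2: "s2 arDef = s arDef"
    using d1 exec_frame[of arDef rounds_cmd s1] by (simp add: s2_def cmd_defs)
  have u2: "s2 arU 0 = u" and n2: "s2 0 0 = n" using f2 by (simp_all add: fixed_def u_def n_def)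
  have t: "t = exec count s3"
    unfolding t_def matching_cmd_def exec.simps(3) s3_def count_def
    by (simp add: s2_def[symmetric] s1_def[symmetric] clear_def[symmetric] u2)
  define Q where "Q r t \<longleftrightarrow> t arU = s2 arU \<and> t arMate = s2 arMate \<and>
      t arDef u = card {i. i < r \<and> s2 arMate i = 0} \<and> (\<forall>v. v \<noteq> u \<longrightarrow> t arDef v = s arDef v)"
    for r and t :: store
  have "Q (s3 0 0 + 0) (exec count s3)" unfolding count_def
  proof (rule exec_Loop_induct)
    show "Q 0 (put arI 0 0 s3)" by (simp add: Q_def s3_def d2)
    fix r t assume "Q r t" "t arI 0 = r"
    then show "Q (Suc r) (put arI 0 (Suc r) (exec (Cond (Arr arMate (Var arI)) Nop
       (Assign arDef (Var arU) (Incr (Arr arDef (Var arU))))) t))"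
      using u2 by (simp add: Q_def card_less_Suc_filter)
  qed simp
  moreover have "s3 0 0 = n" using n2 by (simp add: s3_def)
  ultimately have q: "Q n t" unfolding t by simp
  then show "v \<noteq> u \<Longrightarrow> t arDef v = s arDef v" by (simp add: Q_def)
  have "matching_number {..<s2 0 0} (rel s2) + card {i. i < s2 0 0 \<and> s2 arMate i = 0} = s2 0 0"
    by (rule auction_matching_number) (use rounds(2,3) in \<open>auto simp: core_def all_stuck_def stuck_at_def\<close>)
  moreover have "rel s2 = without u (adj s)" using fixed_rel[OF f2] by (simp add: rel_def u_def)
  ultimately show "t arDef u + matching_number {..<n} (without u (adj s)) = n"
    using q n2 by (simp add: Q_def)
qed

text \<open>The extra pass with \<open>arU = n\<close> deletes no vertex, so entry \<open>n\<close>
  of \<open>arDef\<close> becomes \<open>d\<close> itself.\<close>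

definition table_cmd :: cmd where
  "table_cmd = Loop arU 1 matching_cmd"

lemma table_cmd:
  fixes s
  defines "n \<equiv> s 0 0" and "t \<equiv> exec table_cmd s"
  shows "t 0 = s 0" "adj t = adj s"
    "v \<le> n \<Longrightarrow> t arDef v + matching_number {..<n} (without v (adj s)) = n"
proof -
  define P where "P r t \<longleftrightarrow> t 0 = s 0 \<and> t arAdj = s arAdj \<and> t arRow = s arRow \<and>
    (\<forall>v<r. t arDef v + matching_number {..<n} (without v (adj s)) = n)" for r and t :: store
  have "P (s 0 0 + 1) (exec (Loop arU 1 matching_cmd) s)"
  proof (rule exec_Loop_induct)
    show "P 0 (put arU 0 0 s)" by (simp add: P_def)
    fix r t assume r: "P r t" "t arU 0 = r"
    then have t: "t 0 = s 0" "t arAdj = s arAdj" "t arRow = s arRow" "adj t = adj s"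
      using adj_cong[of t s] by (simp_all add: P_def)
    let ?t = "exec matching_cmd t"
    note m = matching_cmd[where s = t]
    have "?t arDef v + matching_number {..<n} (without v (adj s)) = n" if "v < Suc r" for v
    proof (cases "v = r")
      case True
      then show ?thesis using m(2) r t by (simp add: n_def)
    next
      case False
      then show ?thesis using m(3)[of v] r that by (simp add: P_def)
    qed
    then show "P (Suc r) (put arU 0 (Suc r) ?t)" using m(1) t by (simp add: P_def fixed_def)
  qed (simp add: cmd_defs)
  then have p: "P (n + 1) t" by (simp add: n_def t_def table_cmd_def)
  then show "t 0 = s 0" "adj t = adj s" using adj_cong[of t s] by (simp_all add: P_def)
  show "v \<le> n \<Longrightarrow> t arDef v + matching_number {..<n} (without v (adj s)) = n"
    using p by (simp add: P_def)
qed


section \<open>Evaluating the formula\<close>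

definition has_result :: "store \<Rightarrow> enat \<Rightarrow> bool" where
  "has_result s r \<longleftrightarrow> (case r of enat k \<Rightarrow> s arFin 0 = 1 \<and> s arRes 0 = k | \<infinity> \<Rightarrow> s arFin 0 = 0)"

text \<open>Division by repeated subtraction of 2; \<open>n\<close> passes suffice as
  \<open>d \<le> n\<close>. The test succeeds exactly if the remainder is at least 2.\<close>

definition halve_cmd :: cmd where
  "halve_cmd = Then (Set arRem (Arr arDef (Var 0))) (Then (Set arHalf (Const 0))
    (Loop arI 0 (Cond (Pred (Var arRem))
      (Then (Set arRem (Minus (Var arRem) (Const 2))) (Set arHalf (Incr (Var arHalf)))) Nop)))"

text \<open>Entry \<open>i\<close> of \<open>arDef\<close> is \<open>n\<close> minus the matching
  number without \<open>i\<close>; it may exceed \<open>d\<close> by at most one. The matrix entry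
  ensures that \<open>i\<close> is not isolated.\<close>

definition flag_cmd :: cmd where
  "flag_cmd = Then (Set arFlag (Const 0))
    (Loop arI 0 (Loop arJ 0 (Cond (Arr arAdj (Plus (Arr arRow (Var arI)) (Var arJ)))
      (Cond (Minus (Arr arDef (Var arI)) (Incr (Arr arDef (Var 0)))) Nop (Set arFlag (Const 1))) Nop)))"

definition answer_cmd :: cmd where
  "answer_cmd = Then (Set arFin (Const 1))
    (Cond (Var arRem)
      (Cond (Var arFlag) (Set arRes (Incr (Var arHalf)))
        (Cond (Pred (Var 0)) (Set arRes (Plus (Var arHalf) (Const 2))) (Set arFin (Const 0))))
      (Set arRes (Var arHalf)))"

lemma halve_cmd:
  assumes "s arDef (s 0 0) \<le> s 0 0"
  shows "exec halve_cmd s arRem 0 = s arDef (s 0 0) mod 2" "exec halve_cmd s arHalf 0 = s arDef (s 0 0) div 2"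
proof -
  let ?d = "s arDef (s 0 0)" and ?n = "s 0 0"
  let ?s = "put arHalf 0 0 (put arRem 0 ?d s)"
  let ?c = "Cond (Pred (Var arRem))
      (Then (Set arRem (Minus (Var arRem) (Const 2))) (Set arHalf (Incr (Var arHalf)))) Nop"
  define P where "P r t \<longleftrightarrow> t arRem 0 + 2 * t arHalf 0 = ?d \<and> (t arRem 0 < 2 \<or> t arHalf 0 \<ge> r)"
    for r and t :: store
  have "P (?s 0 0 + 0) (exec (Loop arI 0 ?c) ?s)"
  proof (rule exec_Loop_induct)
    show "P 0 (put arI 0 0 ?s)" by (simp add: P_def)
    fix r t assume "P r t"
    then show "P (Suc r) (put arI 0 (Suc r) (exec ?c t))" by (auto simp: P_def)
  qed simp
  then have "P ?n (exec halve_cmd s)" by (simp add: halve_cmd_def)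
  moreover from this have "exec halve_cmd s arRem 0 < 2" using assms by (auto simp: P_def)
  ultimately show "exec halve_cmd s arRem 0 = ?d mod 2" "exec halve_cmd s arHalf 0 = ?d div 2"
    unfolding P_def by presburger+
qed

lemma flag_cmd:
  "exec flag_cmd s arFlag 0 \<noteq> 0 \<longleftrightarrow>
    (\<exists>i<s 0 0. \<exists>j<s 0 0. adj s i j \<and> s arDef i \<le> s arDef (s 0 0) + 1)" (is "_ \<longleftrightarrow> (\<exists>i<?n. \<exists>j<?n. ?R i j)")
proof -
  let ?s = "put arFlag 0 0 s"
  let ?c = "Cond (Arr arAdj (Plus (Arr arRow (Var arI)) (Var arJ)))
      (Cond (Minus (Arr arDef (Var arI)) (Incr (Arr arDef (Var 0)))) Nop (Set arFlag (Const 1))) Nop"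
  define F where "F t \<longleftrightarrow> t 0 = s 0 \<and> t arAdj = s arAdj \<and> t arRow = s arRow \<and> t arDef = s arDef" for t :: store
  define P where "P i r t \<longleftrightarrow> F t \<and> t arI 0 = i \<and>
      (t arFlag 0 \<noteq> 0 \<longleftrightarrow> (\<exists>i'<i. \<exists>j<?n. ?R i' j) \<or> (\<exists>j<r. ?R i j))" for i r and t :: store
  define Q where "Q r t \<longleftrightarrow> F t \<and> (t arFlag 0 \<noteq> 0 \<longleftrightarrow> (\<exists>i<r. \<exists>j<?n. ?R i j))" for r and t :: store
  have "Q (?s 0 0 + 0) (exec (Loop arI 0 (Loop arJ 0 ?c)) ?s)"
  proof (rule exec_Loop_induct)
    show "Q 0 (put arI 0 0 ?s)" by (simp add: Q_def F_def)
    fix i t assume i: "Q i t" "t arI 0 = i"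
    have "P i (t 0 0 + 0) (exec (Loop arJ 0 ?c) t)"
    proof (rule exec_Loop_induct)
      show "P i 0 (put arJ 0 0 t)" using i by (simp add: P_def Q_def F_def)
      fix r t' assume "P i r t'" "t' arJ 0 = r"
      then show "P i (Suc r) (put arJ 0 (Suc r) (exec ?c t'))"
        by (auto simp: P_def F_def adj_def less_Suc_eq)
    qed simp
    moreover have "t 0 = s 0" using i by (simp add: Q_def F_def)
    ultimately show "Q (Suc i) (put arI 0 (Suc i) (exec (Loop arJ 0 ?c) t))"
      by (simp add: P_def Q_def F_def less_Suc_eq ex_disj_distrib conj_disj_distribR disj_commute)
  qed simp
  then show ?thesis by (simp add: Q_def flag_cmd_def)
qed

definition result_cmd :: cmd where
  "result_cmd = Then halve_cmd (Then flag_cmd answer_cmd)"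

lemma result_cmd:
  fixes s
  defines "n \<equiv> s 0 0" and "d \<equiv> s arDef (s 0 0)"
  assumes d: "d \<le> n"
  shows "has_result (exec result_cmd s)
    (if even d then enat (d div 2)
     else if \<exists>i<n. \<exists>j<n. adj s i j \<and> s arDef i \<le> d + 1 then enat (d div 2 + 1)
     else if n = 1 then \<infinity> else enat (d div 2 + 2))"
proof -
  define s1 where "s1 = exec halve_cmd s"
  define s2 where "s2 = exec flag_cmd s1"
  have f1: "s1 a = s a" if "a \<notin> {arRem, arHalf, arI}" for a
    unfolding s1_def by (rule exec_frame) (use that in \<open>simp add: halve_cmd_def\<close>)
  have f2: "s2 a = s1 a" if "a \<notin> {arFlag, arI, arJ}" for a
    unfolding s2_def by (rule exec_frame) (use that in \<open>simp add: flag_cmd_def\<close>)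
  have rem: "s2 arRem 0 = d mod 2" and half: "s2 arHalf 0 = d div 2" and n: "s2 0 0 = n"
    using halve_cmd[of s] d f1 f2 by (simp_all add: s1_def n_def d_def)
  have "adj s1 = adj s" by (rule adj_cong) (simp_all add: f1)
  then have flag: "s2 arFlag 0 \<noteq> 0 \<longleftrightarrow> (\<exists>i<n. \<exists>j<n. adj s i j \<and> s arDef i \<le> d + 1)"
    using flag_cmd[of s1] f1 by (simp add: s2_def n_def d_def)
  have "n \<noteq> 0" if "odd d" using odd_pos[OF that] d by linarith
  moreover have "exec result_cmd s = exec answer_cmd s2"
    by (simp add: result_cmd_def s1_def s2_def)
  ultimately show ?thesis unfolding flag[symmetric]
    using rem half n by (cases "even d") (auto simp: answer_cmd_def has_result_def odd_iff_mod_2_eq_one)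
qed

text \<open>Row offsets are accumulated by addition, for lack of a multiplication.\<close>

definition rows_cmd :: cmd where
  "rows_cmd = Then (Set arRow (Const 0))
    (Loop arI 0 (Assign arRow (Incr (Var arI)) (Plus (Arr arRow (Var arI)) (Var 0))))"

lemma rows_cmd: "i \<le> s 0 0 \<Longrightarrow> exec rows_cmd s arRow i = i * s 0 0"
proof -
  let ?s = "put arRow 0 0 s"
  let ?c = "Assign arRow (Incr (Var arI)) (Plus (Arr arRow (Var arI)) (Var 0))"
  define P where "P r t \<longleftrightarrow> t 0 = s 0 \<and> (\<forall>i\<le>r. t arRow i = i * s 0 0)" for r and t :: store
  have "P (?s 0 0 + 0) (exec (Loop arI 0 ?c) ?s)"
  proof (rule exec_Loop_induct)
    show "P 0 (put arI 0 0 ?s)" by (simp add: P_def)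
    fix r t assume "P r t" "t arI 0 = r"
    then show "P (Suc r) (put arI 0 (Suc r) (exec ?c t))" by (auto simp: P_def le_Suc_eq)
  qed simp
  then show "i \<le> s 0 0 \<Longrightarrow> exec rows_cmd s arRow i = i * s 0 0" by (simp add: P_def rows_cmd_def)
qed

definition main_cmd :: cmd where
  "main_cmd = Then rows_cmd (Then table_cmd result_cmd)"

lemma main_cmd_ok: "cmd_ok main_cmd"
  by (simp add: main_cmd_def rows_cmd_def table_cmd_def result_cmd_def halve_cmd_def flag_cmd_def
      answer_cmd_def cmd_defs)

lemma main_cmd:
  assumes n: "s 0 0 = n" and R: "\<And>i j. i < n \<Longrightarrow> j < n \<Longrightarrow> R i j \<longleftrightarrow> s arAdj (i * n + j) \<noteq> 0"
    and d: "matching_number {..<n} R + d = n"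
  shows "has_result (exec main_cmd s)
    (if even d then enat (d div 2)
     else if \<exists>i<n. \<exists>j<n. R i j \<and> n \<le> matching_number {..<n} (without i R) + d + 1 then enat (d div 2 + 1)
     else if n = 1 then \<infinity> else enat (d div 2 + 2))"
proof -
  define s1 where "s1 = exec rows_cmd s"
  define s2 where "s2 = exec table_cmd s1"
  have s1: "s1 0 = s 0" "s1 arAdj = s arAdj"
    unfolding s1_def by (rule exec_frame; simp add: rows_cmd_def)+
  have adj: "adj s1 i j \<longleftrightarrow> R i j" if "i < n" "j < n" for i j
    using that R[OF that] rows_cmd[of i s] n by (simp add: adj_def s1[unfolded s1_def] s1_def)
  have s2: "s2 0 = s 0" "adj s2 = adj s1" using table_cmd(1,2)[of s1] s1 by (simp_all add: s2_def)
  \<comment> \<open>The matrix determines the relation only for indices below \<open>n\<close>, so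
    the two relations agree there but need not be equal.\<close>
  have nu: "matching_number {..<n} (without i (adj s1)) = matching_number {..<n} (without i R)" for i
    by (rule matching_number_transfer[where h = id]) (simp_all add: without_def adj)
  have def_i: "s2 arDef i + matching_number {..<n} (without i R) = n" if "i \<le> n" for i
    using table_cmd(3)[of i s1] that n s1 nu by (simp add: s2_def)
  have "matching_number {..<n} (without n R) = matching_number {..<n} R"
    by (rule matching_number_transfer[where h = id]) (simp_all add: without_def)
  then have def_n: "s2 arDef n = d" using def_i[of n] d by simp
  have n2: "s2 0 0 = n" using s2 n by simp
  have "d \<le> n" using d by simp
  from result_cmd[where s = s2, unfolded n2 def_n, OF this] have "has_result (exec result_cmd s2)
    (if even d then enat (d div 2)
     else if \<exists>i<n. \<exists>j<n. adj s2 i j \<and> s2 arDef i \<le> d + 1 then enat (d div 2 + 1)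
     else if n = 1 then \<infinity> else enat (d div 2 + 2))"
    .
  moreover have "(\<exists>i<n. \<exists>j<n. adj s2 i j \<and> s2 arDef i \<le> d + 1) \<longleftrightarrow>
      (\<exists>i<n. \<exists>j<n. R i j \<and> n \<le> matching_number {..<n} (without i R) + d + 1)"
  proof (intro ex_cong1 conj_cong refl)
    fix i j assume "i < n" "j < n"
    then show "adj s2 i j = R i j" using s2 adj by simp
    show "s2 arDef i \<le> d + 1 \<longleftrightarrow> n \<le> matching_number {..<n} (without i R) + d + 1"
      using def_i[of i] \<open>i < n\<close> by linarith
  qed
  moreover have "exec main_cmd s = exec result_cmd s2" by (simp add: main_cmd_def s1_def s2_def)
  ultimately show ?thesis by (simp only:)
qed

section \<open>The machine program\<close>

definition square_loop :: prog where
  "square_loop = While (Mem (Num 2))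
    (Seq (Store (Num 1) (Add (Mem (Num 1)) (Mem (Num 0)))) (Store (Num 2) (Sub (Mem (Num 2)) (Num 1))))"

text \<open>Entry \<open>r\<close> of the input lies at address \<open>r\<close> and moves to
  \<open>32 * (r - 1) + 3\<close>, which is never below \<open>r\<close>; counting down, it cannot
  hit a pending source.\<close>

definition move_loop :: prog where
  "move_loop = While (Mem (Num 1))
    (Seq (Store (cell arAdj (Sub (Mem (Num 1)) (Num 1))) (Mem (Mem (Num 1))))
      (Store (Num 1) (Sub (Mem (Num 1)) (Num 1))))"

text \<open>The matrix is moved into array \<open>arAdj\<close> from its end, so that no entry is overwritten before
  it has been moved. The loops need the cells 1 and 2, which hold two entries of the matrix:
  these have been read off before and are passed as \<open>b\<close> and \<open>b'\<close>.\<close>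

definition move_prog :: "nat \<Rightarrow> nat \<Rightarrow> prog" where
  "move_prog b b' =
    Seq (Store (Num 1) (Num 0)) (Seq (Store (Num 2) (Mem (Num 0))) (Seq square_loop (Seq move_loop
      (Seq (Store (Num 3) (Num b)) (Store (Num 35) (Num b'))))))"

text \<open>For large graphs any fixed address may hold a matrix entry, so the first two entries are
  kept in the control flow instead of in memory.\<close>

definition load_prog :: prog where
  "load_prog = IfElse (Mem (Num 1))
    (IfElse (Mem (Num 2)) (move_prog 1 1) (move_prog 1 0))
    (IfElse (Mem (Num 2)) (move_prog 0 1) (move_prog 0 0))"

lemma runs_square_loop:
  "m 2 = r \<Longrightarrow> runs square_loop m (16 * r + 3) (m(1 := m 1 + r * m 0, 2 := 0))"
proof (induction r arbitrary: m)
  case 0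
  then have "m(1 := m 1 + 0 * m 0, 2 := 0) = m" by auto
  moreover have "runs square_loop m (exp_cost (Mem (Num 2)) + 1) m"
    unfolding square_loop_def by (rule runs.WhileFalse) (use 0 in simp)
  ultimately show ?case by (simp add: eval_nat_numeral)
next
  case (Suc r)
  let ?m1 = "m(1 := m 1 + m 0)"
  let ?m2 = "?m1(2 := r)"
  have 1: "runs (Store (Num 1) (Add (Mem (Num 1)) (Mem (Num 0)))) m 7 ?m1"
    by (rule runs_StoreI) auto
  have 2: "runs (Store (Num 2) (Sub (Mem (Num 2)) (Num 1))) ?m1 6 ?m2"
    by (rule runs_StoreI) (use Suc.prems in auto)
  have "runs square_loop ?m2 (16 * r + 3) (?m2(1 := ?m2 1 + r * ?m2 0, 2 := 0))"
    by (rule Suc.IH) simp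
  moreover have "?m2(1 := ?m2 1 + r * ?m2 0, 2 := 0) = m(1 := m 1 + Suc r * m 0, 2 := 0)" by auto
  ultimately have 3: "runs square_loop ?m2 (16 * r + 3) (m(1 := m 1 + Suc r * m 0, 2 := 0))" by simp
  have "runs square_loop m (exp_cost (Mem (Num 2)) + 1 + (7 + 6) + (16 * r + 3)) (m(1 := m 1 + Suc r * m 0, 2 := 0))"
    unfolding square_loop_def
    by (rule runs.WhileTrue[OF _ runs.Seq[OF 1 2] 3[unfolded square_loop_def]]) (use Suc.prems in simp)
  moreover have "exp_cost (Mem (Num 2)) + 1 + (7 + 6) + (16 * r + 3) = 16 * Suc r + 3" by simp
  ultimately show ?case by (simp only:)
qed

text \<open>Entry 0 of the matrix is left out, as its source, cell 1, is the loop counter. One pass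
  costs 3 for the test, 165 for the move and 6 for the decrement.\<close>

lemma runs_move_loop:
  "m 1 = r \<Longrightarrow> \<exists>m'. runs move_loop m (174 * r + 3) m' \<and>
    (\<forall>i<r. 1 \<le> i \<longrightarrow> m' (32 * i + 3) = m (i + 1)) \<and>
    (\<forall>a. a \<noteq> 1 \<and> (\<forall>i<r. a \<noteq> 32 * i + 3) \<longrightarrow> m' a = m a)"
proof (induction r arbitrary: m)
  case 0
  then have "runs move_loop m (exp_cost (Mem (Num 1)) + 1) m"
    unfolding move_loop_def by (intro runs.WhileFalse) simp
  then show ?case by (intro exI[of _ m]) (simp add: eval_nat_numeral)
next
  case (Suc r)
  let ?m1 = "m(32 * r + 3 := m (Suc r))"
  let ?m2 = "?m1(1 := r)"
  let ?move = "Store (cell arAdj (Sub (Mem (Num 1)) (Num 1))) (Mem (Mem (Num 1)))"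
  have 1: "runs ?move m 165 ?m1"
    by (rule runs_StoreI) (use Suc.prems in \<open>auto simp: cell_def double_def\<close>)
  have 2: "runs (Store (Num 1) (Sub (Mem (Num 1)) (Num 1))) ?m1 6 ?m2"
    by (rule runs_StoreI) (use Suc.prems in auto)
  obtain m' where 3: "runs move_loop ?m2 (174 * r + 3) m'"
    and m': "\<And>i. i < r \<Longrightarrow> 1 \<le> i \<Longrightarrow> m' (32 * i + 3) = ?m2 (i + 1)"
      "\<And>a. a \<noteq> 1 \<Longrightarrow> (\<forall>i<r. a \<noteq> 32 * i + 3) \<Longrightarrow> m' a = ?m2 a"
    using Suc.IH[of ?m2, OF fun_upd_same] by blast
  have "runs move_loop m (exp_cost (Mem (Num 1)) + 1 + (165 + 6) + (174 * r + 3)) m'"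
    unfolding move_loop_def
    by (rule runs.WhileTrue[OF _ runs.Seq[OF 1 2] 3[unfolded move_loop_def]]) (use Suc.prems in simp)
  moreover have "exp_cost (Mem (Num 1)) + 1 + (165 + 6) + (174 * r + 3) = 174 * Suc r + 3" by simp
  ultimately have "runs move_loop m (174 * Suc r + 3) m'" by (simp only:)
  moreover have "m' (32 * i + 3) = m (i + 1)" if "i < Suc r" "1 \<le> i" for i
    using that m'(1)[of i] m'(2)[of "32 * r + 3"] by (cases "i = r") auto
  moreover have "m' a = m a" if "a \<noteq> 1" "\<forall>i<Suc r. a \<noteq> 32 * i + 3" for a
    using that m'(2)[of a] by auto
  ultimately show ?case by blast
qed

lemma runs_move_prog:
  assumes m: "m 0 = n" "m 1 = b" "m 2 = b'"
  shows "\<exists>t m'. runs (move_prog b b') m t m' \<and> t \<le> 174 * (n * n) + 16 * n + 20 \<and> m' 0 = n \<and>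
    (\<forall>i<n * n. m' (32 * i + 3) = m (i + 1))"
proof -
  let ?m1 = "m(1 := 0)"
  let ?m2 = "?m1(2 := n)"
  let ?m3 = "m(1 := n * n, 2 := 0)"
  have 1: "runs (Store (Num 1) (Num 0)) m 3 ?m1" by (rule runs_StoreI) auto
  have 2: "runs (Store (Num 2) (Mem (Num 0))) ?m1 4 ?m2" by (rule runs_StoreI) (use m in auto)
  have "runs square_loop ?m2 (16 * n + 3) (?m2(1 := ?m2 1 + n * ?m2 0, 2 := 0))"
    by (rule runs_square_loop) simp
  moreover have "?m2(1 := ?m2 1 + n * ?m2 0, 2 := 0) = ?m3" using m by auto
  ultimately have 3: "runs square_loop ?m2 (16 * n + 3) ?m3" by simp
  obtain m' where 4: "runs move_loop ?m3 (174 * (n * n) + 3) m'"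
    and m': "\<And>i. i < n * n \<Longrightarrow> 1 \<le> i \<Longrightarrow> m' (32 * i + 3) = ?m3 (i + 1)"
      "\<And>a. a \<noteq> 1 \<Longrightarrow> (\<forall>i<n * n. a \<noteq> 32 * i + 3) \<Longrightarrow> m' a = ?m3 a"
    using runs_move_loop[of ?m3 "n * n"] by auto
  have 5: "runs (Store (Num 3) (Num b)) m' 3 (m'(3 := b))" by (rule runs_StoreI) auto
  have 6: "runs (Store (Num 35) (Num b')) (m'(3 := b)) 3 (m'(3 := b, 35 := b'))" by (rule runs_StoreI) auto
  let ?t = "3 + (4 + (16 * n + 3 + (174 * (n * n) + 3 + (3 + 3))))"
  have "runs (move_prog b b') m ?t (m'(3 := b, 35 := b'))"
    unfolding move_prog_def by (intro runs.Seq) (fact 1 2 3 4 5 6)+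
  moreover have "m' 0 = n" using m'(2)[of 0] m by simp
  moreover have "(m'(3 := b, 35 := b')) (32 * i + 3) = m (i + 1)" if "i < n * n" for i
  proof -
    consider "i = 0" | "i = 1" | "i \<ge> 2" by linarith
    then show ?thesis
    proof cases
      case 3
      then show ?thesis using m'(1)[OF that] by auto
    qed (use m in \<open>auto simp: eval_nat_numeral\<close>)
  qed
  ultimately show ?thesis by (intro exI[of _ ?t] exI[of _ "m'(3 := b, 35 := b')"]) auto
qed

lemma runs_load_prog:
  assumes "m 0 = n" "m 1 \<le> 1" "m 2 \<le> 1"
  shows "\<exists>t m'. runs load_prog m t m' \<and> t \<le> 174 * (n * n) + 16 * n + 26 \<and> m' 0 = n \<and>
    (\<forall>i<n * n. m' (32 * i + 3) = m (i + 1))"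
proof -
  obtain t m' where r: "runs (move_prog (m 1) (m 2)) m t m'" and t: "t \<le> 174 * (n * n) + 16 * n + 20"
    and m': "m' 0 = n" "\<forall>i<n * n. m' (32 * i + 3) = m (i + 1)"
    using runs_move_prog[of m n "m 1" "m 2"] assms(1) by blast
  let ?c = "exp_cost (Mem (Num 1)) + 1 + (exp_cost (Mem (Num 2)) + 1 + t)"
  have "runs load_prog m ?c m'"
  proof (cases "m 1 = 0"; cases "m 2 = 0")
    assume b: "m 1 = 0" "m 2 = 0"
    then show ?thesis unfolding load_prog_def using r
      by (intro runs.IfFalse) simp_all
  next
    assume b: "m 1 = 0" "m 2 \<noteq> 0"
    then have "m 2 = 1" using assms by simp
    then show ?thesis unfolding load_prog_def using r b
      by (intro runs.IfFalse[of "Mem (Num 1)"] runs.IfTrue[of "Mem (Num 2)"]) simp_all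
  next
    assume b: "m 1 \<noteq> 0" "m 2 = 0"
    then have "m 1 = 1" using assms by simp
    then show ?thesis unfolding load_prog_def using r b
      by (intro runs.IfTrue[of "Mem (Num 1)"] runs.IfFalse[of "Mem (Num 2)"]) simp_all
  next
    assume b: "m 1 \<noteq> 0" "m 2 \<noteq> 0"
    then have "m 1 = 1" "m 2 = 1" using assms by simp_all
    then show ?thesis unfolding load_prog_def using r b
      by (intro runs.IfTrue) simp_all
  qed
  then show ?thesis using t m' by (intro exI[of _ ?c] exI[of _ m']) auto
qed

text \<open>Entry 0 of array \<open>a\<close> is cell \<open>a\<close>, so the result is already in
  cell 1; only the finiteness flag must be copied to cell 0, which holds \<open>n\<close> until
  then.\<close>

definition edge_add_prog :: prog where
  "edge_add_prog = Seq load_prog (Seq (compile main_cmd) (Store (Num 0) (Mem (Num arFin))))"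

lemma has_output_of_result:
  assumes "represents m s" "has_result s r"
  shows "has_output (m(0 := m arFin)) r"
  using assms(2) represents_cell0[OF assms(1), of arFin] represents_cell0[OF assms(1), of arRes]
  by (cases r) (auto simp: has_result_def has_output_def)

lemma runs_edge_add_prog:
  assumes m: "m 0 = n" "m 1 \<le> 1" "m 2 \<le> 1"
    and R: "\<And>i j. i < n \<Longrightarrow> j < n \<Longrightarrow> R i j \<longleftrightarrow> m (i * n + j + 1) \<noteq> 0"
    and d: "matching_number {..<n} R + d = n"
  shows "\<exists>t m'. runs edge_add_prog m t m' \<and>
    t \<le> poly ([:30, 16, 174:] + cost main_cmd) n \<and>
    has_output m' (if even d then enat (d div 2)
     else if \<exists>i<n. \<exists>j<n. R i j \<and> n \<le> matching_number {..<n} (without i R) + d + 1 then enat (d div 2 + 1)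
     else if n = 1 then \<infinity> else enat (d div 2 + 2))" (is "\<exists>t m'. _ \<and> _ \<and> has_output m' ?r")
proof -
  obtain t1 m1 where 1: "runs load_prog m t1 m1" "t1 \<le> 174 * (n * n) + 16 * n + 26" "m1 0 = n"
    and m1: "\<And>i. i < n * n \<Longrightarrow> m1 (32 * i + 3) = m (i + 1)"
    using runs_load_prog[OF m] by blast
  let ?s = "array_view m1"
  have s0: "?s 0 0 = n" using 1 by (simp add: array_view_def)
  have "R i j \<longleftrightarrow> ?s arAdj (i * n + j) \<noteq> 0" if "i < n" "j < n" for i j
  proof -
    have "i * n + j < Suc i * n" using that by simp
    also have "\<dots> \<le> n * n" using that by (intro mult_right_mono) auto
    finally show ?thesis using R[OF that] m1[of "i * n + j"] by (simp add: array_view_def)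
  qed
  note res = main_cmd[OF s0 this d]
  obtain t2 m2 where 2: "runs (compile main_cmd) m1 t2 m2" "represents m2 (exec main_cmd ?s)"
      "t2 \<le> poly (cost main_cmd) (?s 0 0)"
    using compile_correct[OF main_cmd_ok represents_array_view] by blast
  have 3: "runs (Store (Num 0) (Mem (Num arFin))) m2 4 (m2(0 := m2 arFin))" by (rule runs_StoreI) auto
  have "runs edge_add_prog m (t1 + (t2 + 4)) (m2(0 := m2 arFin))"
    unfolding edge_add_prog_def by (intro runs.Seq) (fact 1(1) 2(1) 3)+
  moreover have "t1 + (t2 + 4) \<le> poly ([:30, 16, 174:] + cost main_cmd) n"
    using 1(2) 2(3) s0 by (simp add: algebra_simps)
  moreover have "has_output (m2(0 := m2 arFin)) ?r"
    by (rule has_output_of_result[OF 2(2) res])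
  ultimately show ?thesis by blast
qed

section \<open>From the encoding of a graph to the formula\<close>

lemma nth_concat_map:
  assumes "\<And>x. x \<in> set xs \<Longrightarrow> length (f x) = n" "i < length xs" "j < n"
  shows "concat (map f xs) ! (i * n + j) = f (xs ! i) ! j"
  using assms
proof (induction xs arbitrary: i)
  case (Cons x xs)
  then show ?case by (cases i) (auto simp: nth_append algebra_simps)
qed simp

lemma edge_add_nth:
  assumes vs: "distinct vs" and G: "loop_graph (set vs) E"
  defines "n \<equiv> length vs" and "R \<equiv> \<lambda>i j. {vs ! i, vs ! j} \<in> E"
  assumes d: "matching_number {..<n} R + d = n"
  shows "edge_add (set vs) E =
    (if even d then enat (d div 2)
     else if \<exists>i<n. \<exists>j<n. R i j \<and> n \<le> matching_number {..<n} (without i R) + d + 1 then enat (d div 2 + 1)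
     else if n = 1 then \<infinity> else enat (d div 2 + 2))"
proof -
  have bij: "bij_betw ((!) vs) {..<n} (set vs)" using bij_betw_nth[OF vs] by (simp add: n_def)
  have card: "card (set vs) = n" using vs by (simp add: n_def distinct_card)
  have "matching_number {..<n} R = matching_number (set vs) (adjacent E)"
    by (rule matching_number_transfer[OF _ bij]) (simp_all add: R_def adjacent_def)
  then have d': "matching_number (set vs) (adjacent E) + d = card (set vs)" using d card by simp
  have nu: "matching_number {..<n} (without i R) = matching_number (set vs) (without (vs ! i) (adjacent E))"
    if "i < n" for i
    by (rule matching_number_transfer[OF _ bij])
      (use that vs in \<open>auto simp: R_def adjacent_def without_def n_def nth_eq_iff_index_eq\<close>)
  have "(\<exists>u\<in>set vs. \<exists>v\<in>set vs. {u, v} \<in> E \<and>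
        n \<le> matching_number (set vs) (without u (adjacent E)) + d + 1) \<longleftrightarrow>
      (\<exists>i<n. \<exists>j<n. R i j \<and> n \<le> matching_number {..<n} (without i R) + d + 1)"
    (is "?L \<longleftrightarrow> ?I")
  proof
    assume ?L
    then obtain i j where "i < n" "j < n" "R i j"
      "n \<le> matching_number (set vs) (without (vs ! i) (adjacent E)) + d + 1"
      unfolding n_def R_def by (metis in_set_conv_nth)
    then show ?I using nu by metis
  next
    assume ?I
    then obtain i j where "i < n" "j < n" "R i j"
      "n \<le> matching_number (set vs) (without (vs ! i) (adjacent E)) + d + 1" using nu by metis
    then show ?L unfolding n_def R_def using nth_mem by blast
  qed
  then show ?thesis unfolding edge_add_eq[OF G d'] card by (simp only:)
qed

lemma poly_nat_mono: "x \<le> y \<Longrightarrow> poly p x \<le> poly p y" for p :: "nat poly"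
  by (induction p) (auto intro: add_mono mult_mono)

lemma length_le_input_size: "length w \<le> input_size w"
  by (induction w) (auto simp: input_size_def)

theorem theorem8:
  shows "poly_time_computable
    {(vs :: nat list, E). distinct vs \<and> loop_graph (set vs) E}
    adjacency_encoding
    (\<lambda>(vs, E). edge_add (set vs) E)"
  unfolding poly_time_computable_def
proof (rule exI[of _ edge_add_prog], rule exI[of _ "[:30, 16, 174:] + cost main_cmd"], rule ballI)
  fix x :: "nat list \<times> nat set set"
  assume "x \<in> {(vs, E). distinct vs \<and> loop_graph (set vs) E}"
  then obtain vs E where x: "x = (vs, E)" and vs: "distinct vs" and G: "loop_graph (set vs) E" by blast
  let ?w = "adjacency_encoding x" and ?m = "load_input (adjacency_encoding x)"
  define n where "n = length vs"
  define R where "R = (\<lambda>i j. {vs ! i, vs ! j} \<in> E)"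
  define d where "d = n - matching_number {..<n} R"
  have d: "matching_number {..<n} R + d = n"
    using matching_number_le_card[of "{..<n}" R] by (simp add: d_def)
  define row where "row = (\<lambda>u. map (\<lambda>v. if {u, v} \<in> E then 1 else 0 :: nat) vs)"
  have w: "?w = n # concat (map row vs)" by (simp add: x adjacency_encoding_def n_def row_def)
  have len: "length (concat (map row vs)) = n * n"
    by (simp add: length_concat row_def n_def o_def sum_list_triv)
  have m: "?m 0 = n" "?m 1 \<le> 1" "?m 2 \<le> 1"
  proof -
    have "?m a \<le> 1" if "a \<noteq> 0" for a
    proof (cases "a < length ?w")
      case True
      then have "?m a \<in> set (concat (map row vs))"
        using that unfolding load_input_def w by (auto simp del: set_concat)
      then show ?thesis by (auto simp: row_def split: if_splits)
    qed (simp add: load_input_def)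
    then show "?m 1 \<le> 1" "?m 2 \<le> 1" by simp_all
  qed (simp add: load_input_def w)
  have "R i j \<longleftrightarrow> ?m (i * n + j + 1) \<noteq> 0" if "i < n" "j < n" for i j
  proof -
    have "i * n + j < Suc i * n" using that by simp
    also have "\<dots> \<le> n * n" using that by (intro mult_right_mono) auto
    finally have "?m (i * n + j + 1) = concat (map row vs) ! (i * n + j)"
      by (simp add: load_input_def w len)
    also have "\<dots> = row (vs ! i) ! j"
      by (rule nth_concat_map) (use that in \<open>simp_all add: row_def n_def\<close>)
    finally show ?thesis using that by (simp add: row_def R_def n_def)
  qed
  note run = runs_edge_add_prog[OF m this d]
  have "edge_add (set vs) E =
    (if even d then enat (d div 2)
     else if \<exists>i<n. \<exists>j<n. R i j \<and> n \<le> matching_number {..<n} (without i R) + d + 1 then enat (d div 2 + 1)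
     else if n = 1 then \<infinity> else enat (d div 2 + 2))"
    unfolding n_def R_def by (rule edge_add_nth[OF vs G d[unfolded n_def R_def]])
  from run[folded this]
  obtain t m' where run: "runs edge_add_prog ?m t m'" "t \<le> poly ([:30, 16, 174:] + cost main_cmd) n"
    "has_output m' (edge_add (set vs) E)" by blast
  \<comment> \<open>The input consists of \<open>1 + n * n\<close> entries, each of size at least
    1.\<close>
  have "n \<le> input_size ?w"
    using length_le_input_size[of ?w] len by (cases n) (auto simp: w)
  then have "t \<le> poly ([:30, 16, 174:] + cost main_cmd) (input_size ?w)"
    by (rule le_trans[OF run(2) poly_nat_mono])
  then show "\<exists>t m. runs edge_add_prog ?m t m \<and>
      t \<le> poly ([:30, 16, 174:] + cost main_cmd) (input_size ?w) \<and>
      has_output m ((\<lambda>(vs, E). edge_add (set vs) E) x)"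
    using run(1,3) x by auto
qed

end
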